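(* Let $\psi(x)=\sum_{n\le x}\Lambda(n)$, where $\Lambda$ is the Mangoldt function. Then $\psi(x)\sim x$ as $x\to\infty$.
   Context: The Mangoldt function is defined on positive integers by $\Lambda(n)=\log p$ if $n=p^m$ for some prime $p$ and some integer $m\ge 1$, and $\Lambda(n)=0$ otherwise. The notation $f(x)\sim g(x)$ means $\lim_{x\to\infty} f(x)/g(x)=1$. *)

theory Defs
  imports Complex_Main "HOL-Number_Theory.Prime_Powers" "HOL-Library.Landau_Symbols"
begin

definition chebyshev_psi :: "real \<Rightarrow> real" where
  "chebyshev_psi x = (\<Sum>n | 1 \<le> n \<and> real n \<le> x. mangoldt n)"

end

(* Newman's proof of the prime number theorem. Since the convolution of the Mangoldt function with 1
   is the logarithm, its Dirichlet series L satisfies L = -zeta'/zeta for Re s > 1. The function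
   (s - 1) zeta(s) extends to Re s > 0 and has no zeros for Re s >= 1, because
   3 + 4 cos x + cos (2 x) >= 0. By Chebyshev's bound psi(x) = O(x), the integral of
   (psi(x) - x) / x^(s + 1) converges for Re s > 1, and by the above it extends holomorphically to a
   neighbourhood of Re s >= 1. Newman's contour argument then gives convergence at s = 1. As psi is
   monotone, a deviation of psi(x) / x from 1 at some x would persist on an interval [x, a x]
   and contribute a fixed amount to this integral, which contradicts convergence. *)

theory Submission
  imports Defs "HOL-Complex_Analysis.Complex_Analysis" "HOL-Real_Asymp.Real_Asymp"
begin

section \<open>Chebyshev's bound\<close>

text \<open>At Re s = 1 the bound psi(x) = O(x) only makes the integrand O(1/x), so no estimate by
  absolute values reaches s = 1; convergence there has to come from the analytic continuation. The
  integral is cut at the integers, between which psi is constant. Each piece is an entire function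
  of s, bounded by a difference of consecutive powers, so finite sums, tails and locally uniform
  convergence are all controlled by telescoping, and the truncations in Newman's argument are
  partial sums of a series. A zero of zeta is measured by the limit of (z - s) f'(z) / f(z), which
  is its order, a natural number. At 1 + i t with t \<noteq> 0 the trigonometric inequality becomes
  3 - 4 m - l \<ge> 0 for the orders m at 1 + i t and l at 1 + 2 i t, which leaves only m = 0. The
  fixed amount contributed by a deviation is a - 1 - ln a, the integral of (a n - x) / x^2 from n to
  a n, which is positive for every positive a \<noteq> 1.\<close>

lemma ln_fact_eq_sum_mangoldt:
  "ln (fact n :: real) = (\<Sum>d = 1..n. mangoldt d * real (n div d))"
proof (induction n)
  case 0
  then show ?case by simp
next
  case (Suc n)
  have "ln (fact (Suc n) :: real) = ln (real (Suc n)) + ln (fact n)"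
    by (simp only: fact_Suc of_nat_mult of_nat_fact ln_mult_pos fact_gt_zero of_nat_0_less_iff zero_less_Suc)
  also have "ln (real (Suc n)) = (\<Sum>d | d dvd Suc n. mangoldt d)"
    using mangoldt_sum[of "Suc n", where ?'a = real] by simp
  also have "\<dots> = (\<Sum>d = 1..Suc n. if d dvd Suc n then mangoldt d else 0)"
    by (rule sum.mono_neutral_cong_left) (auto intro!: Suc_leI dvd_imp_le intro: dvd_pos_nat[of "Suc n"])
  also have "ln (fact n :: real) = (\<Sum>d = 1..Suc n. mangoldt d * real (n div d))"
    using Suc.IH by simp
  also have "(\<Sum>d = 1..Suc n. if d dvd Suc n then mangoldt d else 0) + \<dots>
      = (\<Sum>d = 1..Suc n. mangoldt d * real (Suc n div d))"
    \<comment> \<open>Passing from n to n + 1 raises \<open>n div d\<close> by one exactly when d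
      divides n + 1.\<close>
    unfolding sum.distrib[symmetric]
    by (intro sum.cong) (auto simp: div_Suc dvd_eq_mod_eq_0 algebra_simps)
  finally show ?case .
qed

text \<open>The weight floor(2n/d) - 2 floor(n/d) is never negative and equals 1 for n < d \<le> 2n.
  So the growth of psi from n to 2n is at most the weighted sum over all d \<le> 2n, which is the
  logarithm of the central binomial coefficient.\<close>

lemma sum_mangoldt_double_le:
  "(\<Sum>d = 1..2*n. mangoldt d) \<le> (\<Sum>d = 1..n. mangoldt d) + 2 * real n * ln (2::real)"
proof -
  have split: "(\<Sum>d = 1..2*n. f d) = (\<Sum>d = 1..n. f d) + (\<Sum>d = n+1..2*n. f d)" for f :: "nat \<Rightarrow> real"
    by (subst sum.union_disjoint[symmetric]) (auto intro!: sum.cong)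
  have "(\<Sum>d = n+1..2*n. mangoldt d) = (\<Sum>d = n+1..2*n. mangoldt d * (real (2*n div d) - 2 * real (n div d)))"
  proof (rule sum.cong)
    fix d assume d: "d \<in> {n+1..2*n}"
    then have "2*n div d = 1" "n div d = 0" by (auto intro!: div_nat_eqI)
    then show "mangoldt d = mangoldt d * (real (2*n div d) - 2 * real (n div d))" by simp
  qed auto
  also have "\<dots> \<le> (\<Sum>d = 1..2*n. mangoldt d * (real (2*n div d) - 2 * real (n div d)))"
  proof (rule sum_mono2)
    fix d :: nat assume "d \<in> {1..2*n} - {n+1..2*n}"
    then have "d > 0" by auto
    have "2 * (n div d) \<le> 2*n div d"
      using \<open>d > 0\<close> by (simp add: less_eq_div_iff_mult_less_eq)
    then have "2 * real (n div d) \<le> real (2*n div d)"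
      by (metis of_nat_le_iff of_nat_mult of_nat_numeral)
    then show "0 \<le> mangoldt d * (real (2*n div d) - 2 * real (n div d))"
      by (simp add: mangoldt_nonneg)
  qed auto
  also have "\<dots> = ln (fact (2*n)) - 2 * (\<Sum>d = 1..2*n. mangoldt d * real (n div d))"
    unfolding ln_fact_eq_sum_mangoldt[of "2*n"] sum_distrib_left sum_subtractf[symmetric]
    by (simp add: algebra_simps)
  also have "(\<Sum>d = 1..2*n. mangoldt d * real (n div d)) = ln (fact n)"
    unfolding ln_fact_eq_sum_mangoldt by (rule sum.mono_neutral_right) auto
  also have "ln (fact (2*n)) - 2 * ln (fact n) = ln (real (2*n choose n))"
  proof -
    have "real (2*n choose n) = fact (2*n) / (fact n * fact n)"
      using binomial_fact[of n "2*n", where ?'a = real] by (simp add: mult_2)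
    then show ?thesis by (simp add: ln_div ln_mult)
  qed
  also have "\<dots> \<le> ln (2 ^ (2*n))"
  proof -
    have "2*n choose n \<le> 2 ^ (2*n)" by (rule binomial_le_pow2)
    then have "real (2*n choose n) \<le> 2 ^ (2*n)" by (metis of_nat_le_iff of_nat_numeral of_nat_power)
    moreover have "0 < 2*n choose n" by (simp add: zero_less_binomial_iff)
    ultimately show ?thesis by (subst ln_le_cancel_iff) auto
  qed
  also have "\<dots> = 2 * real n * ln 2" by (simp add: ln_realpow)
  finally show ?thesis using split[of mangoldt] by simp
qed

text \<open>Strong induction by halving: the costs 2 m ln 2 of the successive doublings behave like
  a geometric series, and the constant 4 leaves room for the rounding at odd n.\<close>

lemma sum_mangoldt_le: "(\<Sum>d = 1..n. mangoldt d) \<le> (4 * real n :: real)"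
proof (induction n rule: less_induct)
  case (less n)
  have ln2: "ln (2::real) \<le> 1" using ln_le_minus_one[of "2::real"] by simp
  have "\<exists>k. n = 2*k \<or> n = 2*k+1" by presburger
  then obtain k where "n = 2*k \<or> n = 2*k+1" by blast
  then consider "n \<le> 1" | m where "n = 2*m" "m \<ge> 1" | m where "n = 2*m+1" "m \<ge> 1"
    by (cases "k = 0") auto
  then show ?case
  proof cases
    case 1
    then have "n = 0 \<or> n = 1" by auto
    then show ?thesis by auto
  next
    case 2
    then have "(\<Sum>d = 1..m. mangoldt d) \<le> 4 * real m" by (intro less) auto
    moreover have "2 * real m * ln 2 \<le> 2 * real m * 1" by (intro mult_left_mono ln2) auto
    ultimately show ?thesis unfolding \<open>n = 2*m\<close> using sum_mangoldt_double_le[of m] by linarith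
  next
    case 3
    \<comment> \<open>An odd n = 2 m + 1 is rounded up to 2 (m + 1). Since m \<ge> 1, m + 1 < n and
      the induction hypothesis applies.\<close>
    then have "(\<Sum>d = 1..m+1. mangoldt d) \<le> 4 * real (m+1)" by (intro less) auto
    moreover have "2 * real (m+1) * ln 2 \<le> 2 * real (m+1) * (3/4)"
      using ln2_le_25_over_36 by (intro mult_left_mono) auto
    moreover have "(\<Sum>d = 1..n. mangoldt d :: real) \<le> (\<Sum>d = 1..2*(m+1). mangoldt d)"
      using 3 by (intro sum_mono2) (auto simp: mangoldt_nonneg)
    ultimately have "(\<Sum>d = 1..n. mangoldt d) \<le> 4 * real (m+1) + 3/2 * real (m+1)"
      using sum_mangoldt_double_le[of "m+1"] by linarith
    also have "\<dots> \<le> 4 * real n" using 3 by simp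
    finally show ?thesis .
  qed
qed

section \<open>Dirichlet series as Mellin transforms\<close>

text \<open>The part over \<open>[n, n + 1]\<close> of the Mellin integral of \<open>A(x) - x\<close>, where \<open>A(x) = A n\<close> on this interval.
  Subtracting \<open>x\<close> removes the pole of the Dirichlet series at \<open>s = 1\<close> when \<open>A(x) \<sim> x\<close>.\<close>

definition block :: "(nat \<Rightarrow> real) \<Rightarrow> nat \<Rightarrow> complex \<Rightarrow> complex" where
  "block A n s = integral {real n..real n + 1} (\<lambda>x. of_real (A n - x) * of_real x powr (- s - 1))"

lemma block_integrable:
  "n > 0 \<Longrightarrow> (\<lambda>x. of_real (A n - x) * of_real x powr (- s - 1) :: complex) integrable_on {real n..real n + 1}"
  by (intro integrable_continuous_real continuous_intros) auto

lemma block_holomorphic: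
  assumes "n > 0"
  shows "block A n holomorphic_on S"
proof -
  have "(\<lambda>s. integral (cbox (real n) (real n + 1)) (\<lambda>x. of_real (A n - x) * of_real x powr (- s - 1) :: complex))
          holomorphic_on UNIV"
  proof (rule leibniz_rule_holomorphic)
    fix s :: complex and x :: real assume "x \<in> cbox (real n) (real n + 1)"
    with assms have "((\<lambda>s. of_real x powr (- s - 1)) has_field_derivative
        Ln (of_real x) * of_real x powr (- s - 1) * (- 1)) (at s)"
      by (intro DERIV_chain2[OF has_field_derivative_powr_right]) (auto intro!: derivative_eq_intros)
    from DERIV_cmult[OF this, of "of_real (A n - x)"]
    show "((\<lambda>s. of_real (A n - x) * of_real x powr (- s - 1)) has_field_derivative
        of_real (A n - x) * (- Ln (of_real x) * of_real x powr (- s - 1))) (at s within UNIV)"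
      by simp
  next
    have "x \<notin> \<real>\<^sub>\<le>\<^sub>0" if "x \<in> of_real ` {real n..real n+1}" for x :: complex
      using that assms by (auto simp: complex_nonpos_Reals_iff)
    with assms show "continuous_on (UNIV \<times> cbox (real n) (real n + 1))
        (\<lambda>(s, x). of_real (A n - x) * (- Ln (of_real x) * of_real x powr (- s - 1)) :: complex)"
      by (auto simp: case_prod_unfold intro!: continuous_intros)
  qed (use block_integrable[OF assms] in auto)
  then show ?thesis
    unfolding block_def[abs_def] by (auto intro: holomorphic_on_subset)
qed

lemma has_integral_powr:
  fixes a b d :: real
  assumes "0 < a" "a \<le> b" "d \<noteq> 0"
  shows "((\<lambda>x. x powr (- d - 1)) has_integral (a powr - d - b powr - d) / d) {a..b}"
proof -
  have "((\<lambda>x. x powr (- d - 1)) has_integral (- (b powr - d) / d - - (a powr - d) / d)) {a..b}"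
    using assms
    by (intro fundamental_theorem_of_calculus)
       (auto intro!: derivative_eq_intros simp flip: has_real_derivative_iff_has_vector_derivative)
  then show ?thesis by (simp add: diff_divide_distrib)
qed

lemma has_integral_powr_complex:
  fixes s :: complex
  assumes "0 < a" "a \<le> b" "s \<noteq> 0"
  shows "((\<lambda>x. of_real x powr (- s - 1)) has_integral (of_real a powr - s - of_real b powr - s) / s) {a..b}"
proof -
  have "((\<lambda>x. of_real x powr (- s - 1)) has_integral
      (- (of_real b powr - s) / s - - (of_real a powr - s) / s)) {a..b}"
  proof (rule fundamental_theorem_of_calculus)
    fix x assume "x \<in> {a..b}"
    then have "((\<lambda>z. - (z powr - s) / s) has_field_derivative of_real x powr (- s - 1)) (at (of_real x))"
      using assms by (auto intro!: derivative_eq_intros simp: complex_nonpos_Reals_iff)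
    from has_vector_derivative_real_field[OF this]
    show "((\<lambda>x. - (of_real x powr - s) / s) has_vector_derivative of_real x powr (- s - 1)) (at x within {a..b})"
      by (simp add: has_vector_derivative_at_within)
  qed (use assms in auto)
  then show ?thesis by (simp add: diff_divide_distrib)
qed

text \<open>Integrating A n x^(-s-1) and x^(-s) separately gives a term of a summation by parts and
  a term that telescopes over n. At s = 1 the second antiderivative would be a logarithm.\<close>

lemma block_eq:
  assumes "n > 0" "s \<noteq> 0" "s \<noteq> 1"
  shows "s * block A n s = A n * (of_nat n powr - s - of_nat (Suc n) powr - s)
           - s / (s - 1) * (of_nat n powr (1 - s) - of_nat (Suc n) powr (1 - s))"
proof -
  have 1: "((\<lambda>x. of_real (A n) * of_real x powr (- s - 1)) has_integral
      A n * ((of_real n powr - s - of_real (real n + 1) powr - s) / s)) {real n..real n + 1}"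
    using assms by (intro has_integral_mult_right has_integral_powr_complex) auto
  have 2: "((\<lambda>x. of_real x powr (- (s - 1) - 1)) has_integral
      (of_real n powr - (s - 1) - of_real (real n + 1) powr - (s - 1)) / (s - 1)) {real n..real n + 1}"
    using assms by (intro has_integral_powr_complex) auto
  have "((\<lambda>x. of_real (A n - x) * of_real x powr (- s - 1)) has_integral
      A n * ((of_real n powr - s - of_real (real n + 1) powr - s) / s)
      - (of_real n powr - (s - 1) - of_real (real n + 1) powr - (s - 1)) / (s - 1)) {real n..real n + 1}"
  proof (rule has_integral_eq[OF _ has_integral_diff[OF 1 2]])
    fix x assume "x \<in> {real n..real n + 1}"
    then have "x > 0" using assms by auto
    then have "of_real x powr (- (s - 1) - 1) = of_real x * of_real x powr (- s - 1)"
      using powr_add[of "of_real x :: complex" 1 "- s - 1"] by simp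
    then show "of_real (A n) * of_real x powr (- s - 1) - of_real x powr (- (s - 1) - 1)
        = of_real (A n - x) * of_real x powr (- s - 1)"
      by (simp add: algebra_simps)
  qed
  then have "block A n s = A n * ((of_real n powr - s - of_real (real n + 1) powr - s) / s)
      - (of_real n powr - (s - 1) - of_real (real n + 1) powr - (s - 1)) / (s - 1)"
    unfolding block_def by (rule integral_unique)
  then show ?thesis
    using assms by (simp add: field_simps)
qed

text \<open>The majorant B x^(-d-1) integrates to a difference of consecutive powers, so these
  bounds telescope when summed. Negative d is allowed: the contour argument needs the bound to the
  left of the critical line as well.\<close>

lemma norm_block_le:
  assumes "n > 0" "d \<noteq> 0" "d \<le> Re s - b"
    and "\<And>x. real n \<le> x \<Longrightarrow> x \<le> real n + 1 \<Longrightarrow> \<bar>A n - x\<bar> \<le> B * x powr b"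
  shows "norm (block A n s) \<le> B * ((real n powr - d - real (Suc n) powr - d) / d)"
proof -
  have "((\<lambda>x. B * x powr (- d - 1)) has_integral B * ((real n powr - d - (real n + 1) powr - d) / d)) {real n..real n + 1}"
    using assms by (intro has_integral_mult_right has_integral_powr) auto
  note maj = this
  have "norm (of_real (A n - x) * of_real x powr (- s - 1) :: complex) \<le> B * x powr (- d - 1)"
    if "x \<in> {real n..real n + 1}" for x
  proof -
    have x: "x \<ge> 1" using that assms by auto
    have B: "\<bar>A n - x\<bar> \<le> B * x powr b" using that assms(4) by auto
    then have "B \<ge> 0" using x by (smt (verit) mult_neg_pos powr_gt_zero)
    have "norm (of_real (A n - x) * of_real x powr (- s - 1) :: complex) = \<bar>A n - x\<bar> * x powr (- Re s - 1)"
      using x by (simp add: norm_mult norm_powr_real_powr flip: of_real_diff)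
    also have "\<dots> \<le> B * x powr b * x powr (- Re s - 1)"
      by (intro mult_right_mono B) auto
    also have "\<dots> = B * x powr (b - Re s - 1)" using x by (simp add: algebra_simps flip: powr_add)
    also have "\<dots> \<le> B * x powr (- d - 1)"
      using x assms \<open>B \<ge> 0\<close> by (intro mult_left_mono powr_mono) auto
    finally show ?thesis .
  qed
  then have "norm (block A n s) \<le> integral {real n..real n + 1} (\<lambda>x. B * x powr (- d - 1))"
    unfolding block_def
    by (intro integral_norm_bound_integral block_integrable[OF assms(1)] has_integral_integrable[OF maj]) auto
  then show ?thesis
    using integral_unique[OF maj] by (simp add: add.commute)
qed

lemma sum_telescope_powr:
  "(\<Sum>n<N. (real (Suc n) powr - d - real (Suc (Suc n)) powr - d) / d) = (1 - real (Suc N) powr - d) / d"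
  unfolding sum_divide_distrib[symmetric]
  using sum_lessThan_telescope'[of "\<lambda>n. real (Suc n) powr - d" N] by simp

lemma sums_telescope_powr:
  assumes "d > 0"
  shows "(\<lambda>n. (real (Suc n) powr - d - real (Suc (Suc n)) powr - d) / d) sums (1 / d)"
proof -
  have "(\<lambda>N. real (Suc N) powr - d) \<longlonglongrightarrow> 0"
    using assms by real_asymp
  then have "(\<lambda>N. (1 - real (Suc N) powr - d) / d) \<longlonglongrightarrow> (1 - 0) / d"
    using assms by (intro tendsto_intros) auto
  then show ?thesis unfolding sums_def sum_telescope_powr by simp
qed

context
  fixes A :: "nat \<Rightarrow> real" and B b :: real
  assumes bound: "\<And>n x. n > 0 \<Longrightarrow> real n \<le> x \<Longrightarrow> x \<le> real n + 1 \<Longrightarrow> \<bar>A n - x\<bar> \<le> B * x powr b"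
begin

lemma uniform_limit_block:
  assumes "d > 0" "\<And>s. s \<in> S \<Longrightarrow> b + d \<le> Re s"
  shows "uniform_limit S (\<lambda>N s. \<Sum>n<N. block A (Suc n) s) (\<lambda>s. \<Sum>n. block A (Suc n) s) sequentially"
proof (rule Weierstrass_m_test)
  show "norm (block A (Suc n) s) \<le> B * ((real (Suc n) powr - d - real (Suc (Suc n)) powr - d) / d)"
    if "s \<in> S" for n s
    using assms(1) assms(2)[OF that] by (intro norm_block_le[where b = b] bound) auto
  show "summable (\<lambda>n. B * ((real (Suc n) powr - d - real (Suc (Suc n)) powr - d) / d))"
    using sums_telescope_powr[OF assms(1)] by (intro summable_mult) (auto simp: sums_iff)
qed

lemma summable_block: "b < Re s \<Longrightarrow> summable (\<lambda>n. block A (Suc n) s)"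
  using tendsto_uniform_limitI[OF uniform_limit_block[of "Re s - b" "{s}"], of s]
  by (auto simp: summable_def sums_def)

lemma suminf_block_holomorphic: "(\<lambda>s. \<Sum>n. block A (Suc n) s) holomorphic_on {s. b < Re s}"
proof (rule holomorphic_uniform_sequence)
  show "open {s. b < Re s}" by (rule open_halfspace_Re_gt)
  show "(\<lambda>s. \<Sum>n<N. block A (Suc n) s) holomorphic_on {s. b < Re s}" for N
    by (intro holomorphic_on_sum block_holomorphic) auto
  fix s assume "s \<in> {s. b < Re s}"
  \<comment> \<open>Half the distance to the line Re = b, so that the closed disc of radius d still
    keeps distance d from it.\<close>
  define d where "d = (Re s - b) / 2"
  have d: "d > 0" using \<open>s \<in> _\<close> by (auto simp: d_def)
  have Re: "b + d \<le> Re z" if "z \<in> cball s d" for z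
  proof -
    have "Re s - Re z \<le> norm (s - z)" using complex_Re_le_cmod[of "s - z"] by simp
    also have "\<dots> \<le> d" using that by (simp add: dist_norm)
    finally show ?thesis by (simp add: d_def field_simps)
  qed
  show "\<exists>d>0. cball s d \<subseteq> {s. b < Re s} \<and>
      uniform_limit (cball s d) (\<lambda>N s. \<Sum>n<N. block A (Suc n) s) (\<lambda>s. \<Sum>n. block A (Suc n) s) sequentially"
    using d Re by (intro exI[of _ d] conjI uniform_limit_block[of d]) (force+)
qed

end

section \<open>Dirichlet series by partial summation\<close>

lemma sum_by_parts_powr:
  fixes a :: "nat \<Rightarrow> real" and s :: complex
  defines "A \<equiv> \<lambda>n. \<Sum>k = 1..n. a k"
  shows "(\<Sum>n<N. of_real (a (Suc n)) * of_nat (Suc n) powr s) =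
    A N * of_nat (Suc N) powr s + (\<Sum>n<N. A (Suc n) * (of_nat (Suc n) powr s - of_nat (Suc (Suc n)) powr s))"
  by (induction N) (simp_all add: A_def algebra_simps)

lemma tendsto_nat_powr_0:
  fixes s :: complex
  assumes "Re s < 0"
  shows "(\<lambda>n. of_nat (Suc n) powr s) \<longlonglongrightarrow> 0"
proof (rule tendsto_norm_zero_cancel)
  have "(\<lambda>n. real (Suc n) powr Re s) \<longlonglongrightarrow> 0"
    using assms by real_asymp
  then show "(\<lambda>n. norm (of_nat (Suc n) powr s :: complex)) \<longlonglongrightarrow> 0"
    by (simp add: norm_powr_real_powr)
qed

text \<open>Summation by parts turns the series into blocks. The boundary term vanishes because A(N)
  = O(N), and the telescoping powers n^(1-s) left over from the subtracted x produce the polar term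
  s / (s - 1).\<close>

lemma dirichlet_series_sums:
  fixes a :: "nat \<Rightarrow> real" and s :: complex
  defines "A \<equiv> \<lambda>n. \<Sum>k = 1..n. a k"
  assumes bound: "\<And>n x. n > 0 \<Longrightarrow> real n \<le> x \<Longrightarrow> x \<le> real n + 1 \<Longrightarrow> \<bar>A n - x\<bar> \<le> B * x powr 1"
    and s: "Re s > 1"
  shows "(\<lambda>n. of_real (a (Suc n)) * of_nat (Suc n) powr - s) sums (s / (s - 1) + s * (\<Sum>n. block A (Suc n) s))"
proof -
  have s0: "s \<noteq> 0" "s \<noteq> 1" using s by auto
  have "(\<lambda>N. of_real (A N) * of_nat (Suc N) powr - s) \<longlonglongrightarrow> 0"
  proof (rule Lim_null_comparison)
    show "\<forall>\<^sub>F N in sequentially. norm (of_real (A N) * of_nat (Suc N) powr - s) \<le> (B + 1) * real (Suc N) powr (1 - Re s)"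
    proof (rule eventually_sequentiallyI[of 1])
      fix N :: nat assume N: "N \<ge> 1"
      \<comment> \<open>The hypothesis is used at the right end x = N + 1, which matches the index
        of the boundary term.\<close>
      have "\<bar>A N - (real N + 1)\<bar> \<le> B * (real N + 1) powr 1"
        using N by (intro bound) auto
      then have "\<bar>A N\<bar> \<le> (B + 1) * real (Suc N)" by (simp add: algebra_simps)
      then have "\<bar>A N\<bar> * real (Suc N) powr - Re s \<le> (B + 1) * real (Suc N) * real (Suc N) powr - Re s"
        by (intro mult_right_mono) auto
      also have "\<dots> = (B + 1) * real (Suc N) powr (1 - Re s)"
        by (simp add: powr_diff powr_minus divide_simps)
      finally show "norm (of_real (A N) * of_nat (Suc N) powr - s) \<le> (B + 1) * real (Suc N) powr (1 - Re s)"
        by (simp add: norm_mult norm_powr_real_powr)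
    qed
    show "(\<lambda>N. (B + 1) * real (Suc N) powr (1 - Re s)) \<longlonglongrightarrow> 0"
      using s by (intro tendsto_mult_right_zero) real_asymp
  qed
  moreover have "(\<lambda>N. \<Sum>n<N. block A (Suc n) s) \<longlonglongrightarrow> (\<Sum>n. block A (Suc n) s)"
    using summable_block[where A = A and B = B and b = 1 and s = s, OF bound] s by (simp add: summable_LIMSEQ)
  moreover have "(\<lambda>N. of_nat (Suc N) powr (1 - s)) \<longlonglongrightarrow> 0"
    using s by (intro tendsto_nat_powr_0) auto
  ultimately have "(\<lambda>N. of_real (A N) * of_nat (Suc N) powr - s + s * (\<Sum>n<N. block A (Suc n) s)
      + s / (s - 1) * (1 - of_nat (Suc N) powr (1 - s))) \<longlonglongrightarrow> 0 + s * (\<Sum>n. block A (Suc n) s) + s / (s - 1) * (1 - 0)"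
    by (intro tendsto_intros)
  moreover have "(\<Sum>n<N. of_real (a (Suc n)) * of_nat (Suc n) powr - s) =
      of_real (A N) * of_nat (Suc N) powr - s + s * (\<Sum>n<N. block A (Suc n) s)
        + s / (s - 1) * (1 - of_nat (Suc N) powr (1 - s))" for N
  proof -
    have "(\<Sum>n<N. s / (s - 1) * (of_nat (Suc n) powr (1 - s) - of_nat (Suc (Suc n)) powr (1 - s)))
        = s / (s - 1) * (1 - of_nat (Suc N) powr (1 - s))"
      unfolding sum_distrib_left[symmetric] using sum_lessThan_telescope'[of "\<lambda>n. of_nat (Suc n) powr (1 - s)" N] by simp
    moreover have "(\<Sum>n<N. A (Suc n) * (of_nat (Suc n) powr - s - of_nat (Suc (Suc n)) powr - s)) =
        (\<Sum>n<N. s * block A (Suc n) s + s / (s - 1) * (of_nat (Suc n) powr (1 - s) - of_nat (Suc (Suc n)) powr (1 - s)))"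
      by (intro sum.cong refl) (subst block_eq, use s0 in auto)
    ultimately show ?thesis
      using sum_by_parts_powr[where a = a and s = "- s" and N = N] by (simp add: A_def sum.distrib sum_distrib_left)
  qed
  ultimately show ?thesis
    unfolding sums_def by (simp add: add.commute)
qed

section \<open>Products of absolutely convergent Dirichlet series\<close>

lemma has_sum_mult:
  fixes f :: "'a \<Rightarrow> complex" and g :: "'b \<Rightarrow> complex"
  assumes f: "(f has_sum S) X" "(\<lambda>x. norm (f x)) summable_on X" and g: "(g has_sum T) Y" "(\<lambda>y. norm (g y)) summable_on Y"
  shows "((\<lambda>(x, y). f x * g y) has_sum (S * T)) (X \<times> Y)"
proof (rule has_sum_SigmaI)
  show "((\<lambda>y. case (x, y) of (x, y) \<Rightarrow> f x * g y) has_sum f x * T) Y" for x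
    using has_sum_cmult_right[OF g(1), of "f x"] by simp
  show "((\<lambda>x. f x * T) has_sum S * T) X"
    using has_sum_cmult_left[OF f(1), of T] by simp
  have "(\<lambda>x. infsum (\<lambda>y. norm (f x * g y)) Y) = (\<lambda>x. norm (f x) * infsum (\<lambda>y. norm (g y)) Y)"
    using g(2) by (simp add: norm_mult infsum_cmult_right)
  then have "(\<lambda>p. norm (case p of (x, y) \<Rightarrow> f x * g y)) summable_on X \<times> Y"
    unfolding Infinite_Sum.abs_summable_on_Sigma_iff
    using f(2) g(2) by (auto simp: norm_mult infsum_nonneg intro!: summable_on_cmult_left summable_on_cmult_right)
  then show "(\<lambda>(x, y). f x * g y) summable_on X \<times> Y"
    by (rule abs_summable_summable)
qed

text \<open>Absolute convergence permits regrouping the double series over pairs (d, m) by their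
  product n = d m; the pairs with product n correspond to the divisors d of n.\<close>

lemma dirichlet_series_mult:
  fixes a b :: "nat \<Rightarrow> complex" and s :: complex
  assumes a: "summable (\<lambda>n. norm (a (Suc n) * of_nat (Suc n) powr s))"
    and b: "summable (\<lambda>n. norm (b (Suc n) * of_nat (Suc n) powr s))"
  shows "(\<lambda>n. (\<Sum>d | d dvd Suc n. a d * b (Suc n div d)) * of_nat (Suc n) powr s) sums
           ((\<Sum>n. a (Suc n) * of_nat (Suc n) powr s) * (\<Sum>n. b (Suc n) * of_nat (Suc n) powr s))"
proof -
  let ?f = "\<lambda>a n. a n * (of_nat n powr s :: complex)"
  have 1: "(?f a has_sum (\<Sum>n. ?f a (Suc n))) {0<..}" "(\<lambda>n. norm (?f a n)) summable_on {0<..}"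
    if "summable (\<lambda>n. norm (?f a (Suc n)))" for a :: "nat \<Rightarrow> complex"
  proof -
    have bij: "bij_betw Suc UNIV {0<..}"
      by (intro bij_betwI[of _ _ _ "\<lambda>n. n - 1"]) auto
    have "((\<lambda>n. ?f a (Suc n)) has_sum (\<Sum>n. ?f a (Suc n))) UNIV"
      using that by (intro norm_summable_imp_has_sum summable_sums) (auto dest: summable_norm_cancel)
    then show "(?f a has_sum (\<Sum>n. ?f a (Suc n))) {0<..}"
      using has_sum_reindex_bij_betw[OF bij, of "?f a"] by simp
    have "(\<lambda>n. norm (?f a (Suc n))) summable_on UNIV"
      using that by (intro norm_summable_imp_summable_on) auto
    then show "(\<lambda>n. norm (?f a n)) summable_on {0<..}"
      using summable_on_reindex_bij_betw[OF bij, of "\<lambda>n. norm (?f a n)"] by simp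
  qed
  have "((\<lambda>(x, y). ?f a x * ?f b y) has_sum ((\<Sum>n. ?f a (Suc n)) * (\<Sum>n. ?f b (Suc n)))) ({0<..} \<times> {0<..})"
    by (intro has_sum_mult 1 a b)
  also have "?this \<longleftrightarrow> ((\<lambda>(n, d). a d * b (n div d) * of_nat n powr s) has_sum
      ((\<Sum>n. ?f a (Suc n)) * (\<Sum>n. ?f b (Suc n)))) (Sigma {0<..} (\<lambda>n. {d. d dvd n}))"
  proof (rule has_sum_reindex_bij_witness[where i = "\<lambda>(n, d). (d, n div d)" and j = "\<lambda>(d, m). (d * m, d)"], goal_cases)
    case (5 x)
    then show ?case
      by (cases x) (simp add: powr_times_real mult_ac)
  qed (auto elim!: dvdE)
  finally have "((\<lambda>n. \<Sum>d | d dvd n. a d * b (n div d) * of_nat n powr s) has_sum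
      ((\<Sum>n. ?f a (Suc n)) * (\<Sum>n. ?f b (Suc n)))) {0<..}"
    by (rule has_sum_SigmaD) (auto intro!: has_sum_finiteI)
  then have "((\<lambda>n. \<Sum>d | d dvd Suc n. a d * b (Suc n div d) * of_nat (Suc n) powr s) has_sum
      ((\<Sum>n. ?f a (Suc n)) * (\<Sum>n. ?f b (Suc n)))) UNIV"
    by (subst has_sum_reindex_bij_witness[where j = Suc and i = "\<lambda>n. n - 1" and T = "{0<..}"
          and h = "\<lambda>n. \<Sum>d | d dvd n. a d * b (n div d) * of_nat n powr s"]) auto
  then show ?thesis
    by (simp add: has_sum_imp_sums sum_distrib_right)
qed

section \<open>The zeta function and its logarithmic derivative\<close>

text \<open>The value at \<open>s\<close> is \<open>(s - 1) \<zeta>(s)\<close>: this is \<open>dirichlet_series_sums\<close> with \<open>a = 1\<close>, multiplied by \<open>s - 1\<close>.\<close>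

definition reg_zeta :: "complex \<Rightarrow> complex" where
  "reg_zeta s = s + s * (s - 1) * (\<Sum>n. block real (Suc n) s)"

definition mangoldt_series :: "complex \<Rightarrow> complex" where
  "mangoldt_series s = (\<Sum>n. mangoldt (Suc n) * of_nat (Suc n) powr - s)"

abbreviation psi :: "nat \<Rightarrow> real" where "psi n \<equiv> (\<Sum>k = 1..n. mangoldt k)"

text \<open>The exponent 0 is what continues zeta: the block series for the coefficients 1 converges
  for Re s > 0, past the line Re s = 1.\<close>

lemma floor_bound: "real n \<le> x \<Longrightarrow> x \<le> real n + 1 \<Longrightarrow> n > 0 \<Longrightarrow> \<bar>real n - x\<bar> \<le> 1 * x powr 0"
  by auto

text \<open>Chebyshev's bound gives only exponent 1, hence convergence of the blocks of
  \<open>psi\<close> for Re s > 1. Gaining the boundary point s = 1 is the task of the Tauberian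
  theorem.\<close>

lemma psi_bound:
  assumes "n > 0" "real n \<le> x"
  shows "\<bar>psi n - x\<bar> \<le> 4 * x powr 1"
proof -
  have "psi n \<le> 4 * x" using sum_mangoldt_le[of n] assms by linarith
  moreover have "psi n \<ge> 0" by (intro sum_nonneg mangoldt_nonneg)
  ultimately show ?thesis using assms by (auto simp: abs_if)
qed

lemma reg_zeta_holomorphic: "reg_zeta holomorphic_on {s. Re s > 0}"
  unfolding reg_zeta_def[abs_def]
  by (intro holomorphic_intros suminf_block_holomorphic[where B = 1] floor_bound)

lemma reg_zeta_1 [simp]: "reg_zeta 1 = 1"
  by (simp add: reg_zeta_def)

lemma zeta_sums:
  assumes "Re s > 1"
  shows "(\<lambda>n. of_nat (Suc n) powr - s) sums (reg_zeta s / (s - 1))"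
proof -
  have id: "(\<lambda>n. \<Sum>k = 1..n. 1 :: real) = real" by auto
  have "\<bar>(\<Sum>k = 1..n. 1 :: real) - x\<bar> \<le> 1 * x powr 1" if "n > 0" "real n \<le> x" "x \<le> real n + 1" for n x
    using that by (auto simp: abs_if)
  from dirichlet_series_sums[OF this assms]
  have "(\<lambda>n. of_nat (Suc n) powr - s) sums (s / (s - 1) + s * (\<Sum>n. block real (Suc n) s))"
    unfolding id by simp
  moreover have "s \<noteq> 1" using assms by auto
  ultimately show ?thesis
    by (simp add: reg_zeta_def add_divide_distrib)
qed

lemma mangoldt_series_sums:
  assumes "Re s > 1"
  shows "(\<lambda>n. mangoldt (Suc n) * of_nat (Suc n) powr - s) sums (s / (s - 1) + s * (\<Sum>n. block psi (Suc n) s))"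
  using dirichlet_series_sums[OF psi_bound assms] by simp

lemma mangoldt_series_eq:
  assumes "Re s > 1"
  shows "mangoldt_series s = s / (s - 1) + s * (\<Sum>n. block psi (Suc n) s)"
  using mangoldt_series_sums[OF assms] by (simp add: mangoldt_series_def sums_iff)

lemma norm_powr_Suc: "norm (of_nat (Suc n) powr s :: complex) = real (Suc n) powr Re s"
  by (simp add: norm_powr_real_powr)

lemma of_nat_powr_of_real: "of_nat n powr - of_real x = (of_real (real n powr - x) :: complex)"
  using powr_of_real[of "real n" "- x"] by simp

text \<open>The norm of n^(-s) depends only on Re s, and at the real point Re s the convergent
  series already consists of these norms.\<close>

lemma zeta_abs_summable: 
  assumes "Re s > 1"
  shows "summable (\<lambda>n. norm (of_nat (Suc n) powr - s :: complex))"
proof -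
  have "summable (\<lambda>n. of_nat (Suc n) powr - of_real (Re s) :: complex)"
    using zeta_sums[of "of_real (Re s)"] assms by (auto simp: sums_iff)
  then have "summable (\<lambda>n. of_real (real (Suc n) powr - Re s) :: complex)"
    unfolding of_nat_powr_of_real .
  then show ?thesis
    unfolding norm_powr_Suc summable_of_real_iff by simp
qed

lemma mangoldt_abs_summable:
  assumes "Re s > 1"
  shows "summable (\<lambda>n. norm (mangoldt (Suc n) * of_nat (Suc n) powr - s :: complex))"
proof -
  have "summable (\<lambda>n. mangoldt (Suc n) * of_nat (Suc n) powr - of_real (Re s) :: complex)"
    using mangoldt_series_sums[of "of_real (Re s)"] assms by (auto simp: sums_iff)
  also have "(\<lambda>n. mangoldt (Suc n) * of_nat (Suc n) powr - of_real (Re s) :: complex)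
      = (\<lambda>n. of_real (mangoldt (Suc n) * real (Suc n) powr - Re s))"
    unfolding of_nat_powr_of_real of_real_mult of_real_mangoldt ..
  finally show ?thesis
    unfolding norm_mult norm_powr_Suc summable_of_real_iff norm_mangoldt by simp
qed

lemma ln_series_sums:
  assumes "Re s > 1"
  shows "(\<lambda>n. of_real (ln (real (Suc n))) * of_nat (Suc n) powr - s) sums (mangoldt_series s * (reg_zeta s / (s - 1)))"
proof -
  have "(\<lambda>n. (\<Sum>d | d dvd Suc n. mangoldt d * 1) * of_nat (Suc n) powr - s) sums
      ((\<Sum>n. mangoldt (Suc n) * of_nat (Suc n) powr - s) * (\<Sum>n. 1 * of_nat (Suc n) powr - s))"
    using mangoldt_abs_summable[OF assms] zeta_abs_summable[OF assms]
    by (intro dirichlet_series_mult[where b = "\<lambda>_. 1"]) (simp_all only: mult_1_left)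
  then show ?thesis
    unfolding mult_1_left mult_1_right mangoldt_series_def sums_unique[OF zeta_sums[OF assms], symmetric]
    by (simp only: mangoldt_sum[OF nat.distinct(2)])
qed

text \<open>Termwise differentiation produces the coefficients -ln n, whose series has been
  identified through the convolution identity. Near s the terms are dominated by those at the real
  point 1 + d, halfway between 1 and Re s.\<close>

lemma zeta_has_field_derivative:
  assumes "Re s > 1"
  shows "((\<lambda>s. reg_zeta s / (s - 1)) has_field_derivative - (mangoldt_series s * (reg_zeta s / (s - 1)))) (at s)"
proof -
  define S where "S = {s. Re s > (1 :: real)}"
  have S: "open S" unfolding S_def by (rule open_halfspace_Re_gt)
  have "\<exists>g g'. \<forall>s\<in>S. ((\<lambda>n. of_nat (Suc n) powr - s) sums g s) \<and>
      ((\<lambda>n. - of_real (ln (real (Suc n))) * of_nat (Suc n) powr - s) sums g' s) \<and> (g has_field_derivative g' s) (at s)"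
  proof (rule series_and_derivative_comparison_local[OF S])
    fix n and s :: complex
    have "((\<lambda>s. of_nat (Suc n) powr - s) has_field_derivative
        Ln (of_nat (Suc n)) * of_nat (Suc n) powr - s * (- 1)) (at s)"
      by (intro DERIV_chain2[OF has_field_derivative_powr_right]) (auto intro!: derivative_eq_intros simp del: of_nat_Suc)
    then show "((\<lambda>s. of_nat (Suc n) powr - s) has_field_derivative
        - of_real (ln (real (Suc n))) * of_nat (Suc n) powr - s) (at s)"
      using Ln_of_real[of "real (Suc n)"] by simp
  next
    fix s assume "s \<in> S"
    define d where "d = (Re s - 1) / 2"
    have d: "d > 0" using \<open>s \<in> S\<close> by (simp add: d_def S_def)
    have "norm (of_nat (Suc n) powr - z :: complex) \<le> norm (of_nat (Suc n) powr - of_real (1 + d) :: complex)"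
      if "z \<in> ball s d" for z n
    proof -
      have "Re s - Re z \<le> norm (s - z)" using complex_Re_le_cmod[of "s - z"] by simp
      also have "\<dots> \<le> d" using that by (simp add: dist_norm)
      finally have "1 + d \<le> Re z" by (simp add: d_def field_simps)
      then show ?thesis unfolding norm_powr_Suc by (intro powr_mono) auto
    qed
    moreover have "summable (\<lambda>n. norm (of_nat (Suc n) powr - of_real (1 + d) :: complex))"
      using d by (intro zeta_abs_summable) auto
    ultimately show "\<exists>d h. 0 < d \<and> summable h \<and>
        (\<forall>\<^sub>F n in sequentially. \<forall>z\<in>ball s d \<inter> S. norm (of_nat (Suc n) powr - z :: complex) \<le> h n)"
      using d by (intro exI[of _ d] exI[of _ "\<lambda>n. norm (of_nat (Suc n) powr - of_real (1 + d) :: complex)"]) auto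
  qed
  then obtain g g' where g: "\<And>s. s \<in> S \<Longrightarrow> (\<lambda>n. of_nat (Suc n) powr - s) sums g s"
      "\<And>s. s \<in> S \<Longrightarrow> (\<lambda>n. - of_real (ln (real (Suc n))) * of_nat (Suc n) powr - s) sums g' s"
      "\<And>s. s \<in> S \<Longrightarrow> (g has_field_derivative g' s) (at s)"
    by blast
  have s: "s \<in> S" using assms by (simp add: S_def)
  have g': "g' s = - (mangoldt_series s * (reg_zeta s / (s - 1)))"
    using g(2)[OF s] sums_minus[OF ln_series_sums[OF assms]] by (simp add: sums_iff)
  have "g z = reg_zeta z / (z - 1)" if "z \<in> S" for z
    using g(1)[OF that] zeta_sums[of z] that sums_unique2 unfolding S_def by blast
  from has_field_derivative_transform_within_open[OF g(3)[OF s] S s this]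
  show ?thesis unfolding g' .
qed

text \<open>Logarithmic differentiation of (s - 1) zeta(s), in multiplied-out form because
  non-vanishing is not yet known; this identity is what proves it.\<close>

lemma reg_zeta_deriv:
  assumes "Re s > 1"
  shows "deriv reg_zeta s = reg_zeta s * (1 / (s - 1) - mangoldt_series s)"
proof -
  have s: "s \<noteq> 1" using assms by auto
  have "((\<lambda>s. (s - 1) * (reg_zeta s / (s - 1))) has_field_derivative
      (1 * (reg_zeta s / (s - 1)) + - (mangoldt_series s * (reg_zeta s / (s - 1))) * (s - 1))) (at s)"
    by (intro DERIV_mult zeta_has_field_derivative assms) (auto intro!: derivative_eq_intros)
  moreover have "open {s. Re s > (1 :: real)}" by (rule open_halfspace_Re_gt)
  ultimately have "(reg_zeta has_field_derivative
      (1 * (reg_zeta s / (s - 1)) + - (mangoldt_series s * (reg_zeta s / (s - 1))) * (s - 1))) (at s)"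
    by (rule has_field_derivative_transform_within_open) (use assms in auto)
  then have "deriv reg_zeta s = reg_zeta s / (s - 1) - mangoldt_series s * (reg_zeta s / (s - 1) * (s - 1))"
    by (simp only: DERIV_imp_deriv) simp
  moreover have "reg_zeta s / (s - 1) * (s - 1) = reg_zeta s"
    using s by simp
  ultimately show ?thesis
    by (simp only:) (simp add: right_diff_distrib mult.commute)
qed

section \<open>Non-vanishing on the line of real part 1\<close>

text \<open>Writing f = (z - z0)^m g with g nonzero near z0 gives f'/f = m / (z - z0) + g'/g, and
  the last term is continuous at z0. So m is the order of the zero; the point w excludes f = 0
  identically.\<close>

lemma log_deriv_order:
  assumes f: "f holomorphic_on S" and S: "open S" "connected S" and "z0 \<in> S" and "w \<in> S" "f w \<noteq> 0"
  obtains m :: nat where "((\<lambda>z. (z - z0) * (deriv f z / f z)) \<longlongrightarrow> of_nat m) (at z0)" "m = 0 \<longleftrightarrow> f z0 \<noteq> 0"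
proof -
  have cont: "((\<lambda>z. (z - z0) * (deriv g z / g z)) \<longlongrightarrow> 0) (at z0)"
    if "g holomorphic_on T" "open T" "z0 \<in> T" "g z0 \<noteq> 0" for g T
  proof -
    have "isCont g z0" "isCont (deriv g) z0"
      using that holomorphic_deriv[OF that(1,2)]
      by (meson field_differentiable_imp_continuous_at holomorphic_on_imp_differentiable_at)+
    then have "((\<lambda>z. (z - z0) * (deriv g z / g z)) \<longlongrightarrow> (z0 - z0) * (deriv g z0 / g z0)) (at z0)"
      using that by (intro tendsto_intros) (auto simp: isCont_def)
    then show ?thesis by simp
  qed
  show thesis
  proof (cases "f z0 = 0")
    case False
    then show ?thesis using cont[of f S] assms that[of 0] by auto
  next
    case True
    have "\<not> f constant_on S"
      using assms True by (metis constant_on_def)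
    then obtain g r n where g: "0 < n" "0 < r" "ball z0 r \<subseteq> S" "g holomorphic_on ball z0 r"
        "\<And>w. w \<in> ball z0 r \<Longrightarrow> f w = (w - z0) ^ n * g w" "\<And>w. w \<in> ball z0 r \<Longrightarrow> g w \<noteq> 0"
      using holomorphic_factor_zero_nonconstant[OF f S \<open>z0 \<in> S\<close> True] by metis
    have "((\<lambda>z. of_nat n + (z - z0) * (deriv g z / g z)) \<longlongrightarrow> of_nat n + 0) (at z0)"
      using g by (intro tendsto_add tendsto_const cont[of _ "ball z0 r"]) auto
    moreover have "\<forall>\<^sub>F z in at z0. of_nat n + (z - z0) * (deriv g z / g z) = (z - z0) * (deriv f z / f z)"
    proof (rule eventually_at_in_open'[THEN eventually_rev_mp])
      show "open (ball z0 r)" "z0 \<in> ball z0 r" using g by auto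
      have "of_nat n + (z - z0) * (deriv g z / g z) = (z - z0) * (deriv f z / f z)"
        if z: "z \<in> ball z0 r" "z \<noteq> z0" for z
      proof -
        have "(g has_field_derivative deriv g z) (at z)"
          using g z by (auto intro: holomorphic_derivI)
        then have "((\<lambda>w. (w - z0) ^ n * g w) has_field_derivative
            of_nat n * (z - z0) ^ (n - 1) * g z + deriv g z * (z - z0) ^ n) (at z)"
          by (auto intro!: derivative_eq_intros)
        then have "(f has_field_derivative of_nat n * (z - z0) ^ (n - 1) * g z + deriv g z * (z - z0) ^ n) (at z)"
          by (rule has_field_derivative_transform_within_open[of _ _ _ "ball z0 r"]) (use g z in auto)
        then have d: "deriv f z = of_nat n * (z - z0) ^ (n - 1) * g z + deriv g z * (z - z0) ^ n"
          by (rule DERIV_imp_deriv)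
        have p: "(z - z0) ^ n = (z - z0) * (z - z0) ^ (n - 1)"
          using g(1) by (metis power_minus_mult mult.commute)
        show ?thesis
          unfolding d g(5)[OF z(1)] p using z g(6)[OF z(1)] by (simp add: field_simps)
      qed
      then show "\<forall>\<^sub>F z in at z0. z \<in> ball z0 r \<longrightarrow>
          of_nat n + (z - z0) * (deriv g z / g z) = (z - z0) * (deriv f z / f z)"
        by (auto simp: eventually_at intro!: exI[of _ 1])
    qed
    ultimately have "((\<lambda>z. (z - z0) * (deriv f z / f z)) \<longlongrightarrow> of_nat n) (at z0)"
      by (simp add: tendsto_cong)
    then show ?thesis using that True g(1) by blast
  qed
qed

lemma reg_zeta_order:
  assumes "Re s > 0"
  obtains m :: nat where "((\<lambda>z. (z - s) * (deriv reg_zeta z / reg_zeta z)) \<longlongrightarrow> of_nat m) (at s)"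
    "m = 0 \<longleftrightarrow> reg_zeta s \<noteq> 0"
proof (rule log_deriv_order[OF reg_zeta_holomorphic])
  show "open {s. Re s > 0}" by (rule open_halfspace_Re_gt)
  show "connected {s. Re s > 0}" by (intro convex_connected convex_halfspace_Re_gt)
  show "s \<in> {s. Re s > 0}" "1 \<in> {s. Re s > 0}" "reg_zeta 1 \<noteq> 0" using assms by auto
qed

lemma isCont_mangoldt_series:
  assumes "Re s > 1"
  shows "isCont mangoldt_series s"
proof -
  have S: "open {s. Re s > (1 :: real)}" by (rule open_halfspace_Re_gt)
  have "(\<lambda>s. \<Sum>n. block psi (Suc n) s) holomorphic_on {s. Re s > 1}"
    by (rule suminf_block_holomorphic[OF psi_bound])
  moreover have "\<forall>s\<in>{s. Re s > 1}. s - 1 \<noteq> 0" by auto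
  ultimately have "(\<lambda>s. s / (s - 1) + s * (\<Sum>n. block psi (Suc n) s)) holomorphic_on {s. Re s > 1}"
    by (intro holomorphic_intros) auto
  then have "mangoldt_series holomorphic_on {s. Re s > 1}"
    by (rule holomorphic_transform) (simp add: mangoldt_series_eq)
  then show ?thesis
    using holomorphic_on_imp_continuous_on continuous_on_eq_continuous_at[OF S] assms by blast
qed

text \<open>At a zero the logarithmic derivative would have a simple pole, but it equals
  \<open>1 / (s - 1) - mangoldt_series s\<close>, which is continuous for \<open>Re s > 1\<close>. So no Euler product is needed.\<close>

lemma reg_zeta_nonzero_gt_1:
  assumes "Re s > 1"
  shows "reg_zeta s \<noteq> 0"
proof -
  have S: "open {s. Re s > (1 :: real)}" by (rule open_halfspace_Re_gt)
  obtain m :: nat where m: "((\<lambda>z. (z - s) * (deriv reg_zeta z / reg_zeta z)) \<longlongrightarrow> of_nat m) (at s)"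
      "m = 0 \<longleftrightarrow> reg_zeta s \<noteq> 0"
    using reg_zeta_order[of s] assms by auto
  have "((\<lambda>z. (z - s) * (1 / (z - 1) - mangoldt_series z)) \<longlongrightarrow> (s - s) * (1 / (s - 1) - mangoldt_series s)) (at s)"
    using isCont_mangoldt_series[OF assms] assms by (intro tendsto_intros) (auto simp: isCont_def)
  then have lim0: "((\<lambda>z. norm ((z - s) * (1 / (z - 1) - mangoldt_series z))) \<longlongrightarrow> 0) (at s)"
    by (intro tendsto_norm_zero) simp
  have "((\<lambda>z. (z - s) * (deriv reg_zeta z / reg_zeta z)) \<longlongrightarrow> 0) (at s)"
  \<comment> \<open>Only an inequality is available: where \<open>reg_zeta\<close> vanishes near s,
    the quotient is 0 by the convention on division.\<close>
  proof (rule Lim_null_comparison[OF _ lim0])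
    have "\<forall>\<^sub>F z in at s. Re z > 1"
      using eventually_at_in_open'[OF S, of s] assms by simp
    then show "\<forall>\<^sub>F z in at s. norm ((z - s) * (deriv reg_zeta z / reg_zeta z))
        \<le> norm ((z - s) * (1 / (z - 1) - mangoldt_series z))"
    proof eventually_elim
      case (elim z)
      then show ?case by (cases "reg_zeta z = 0") (auto simp: reg_zeta_deriv)
    qed
  qed
  then have "of_nat m = (0 :: complex)"
    using m(1) by (intro tendsto_unique[OF _ m(1)]) auto
  then show ?thesis using m(2) by simp
qed

text \<open>This is the residue of -zeta'/zeta at 1 + i t, reached along a horizontal ray from the
  right: 1 from the pole of zeta when t = 0, minus the order m of the zero of
  \<open>reg_zeta\<close>.\<close>

lemma mangoldt_series_limit:
  obtains m :: nat where
    "((\<lambda>\<sigma>. (\<sigma> - 1) * Re (mangoldt_series (Complex \<sigma> t))) \<longlongrightarrow> (if t = 0 then 1 else 0) - real m) (at_right 1)"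
    "m = 0 \<longleftrightarrow> reg_zeta (Complex 1 t) \<noteq> 0"
proof -
  obtain m :: nat where m: "((\<lambda>z. (z - Complex 1 t) * (deriv reg_zeta z / reg_zeta z)) \<longlongrightarrow> of_nat m) (at (Complex 1 t))"
      "m = 0 \<longleftrightarrow> reg_zeta (Complex 1 t) \<noteq> 0"
    using reg_zeta_order[of "Complex 1 t"] by auto
  have c: "Complex \<sigma> t = of_real \<sigma> + \<i> * of_real t" for \<sigma>
    by (simp add: complex_eq_iff)
  have "((\<lambda>\<sigma>. Complex \<sigma> t) \<longlongrightarrow> Complex 1 t) (at_right 1)"
    unfolding c by (intro tendsto_intros)
  moreover have "\<forall>\<^sub>F \<sigma> in at_right 1. Complex \<sigma> t \<noteq> Complex 1 t"
    by (auto simp: eventually_at intro: exI[of _ 1])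
  ultimately have "filterlim (\<lambda>\<sigma>. Complex \<sigma> t) (at (Complex 1 t)) (at_right 1)"
    by (auto simp: filterlim_at)
  from filterlim_compose[OF m(1) this]
  have 1: "((\<lambda>\<sigma>. of_real (\<sigma> - 1) * (deriv reg_zeta (Complex \<sigma> t) / reg_zeta (Complex \<sigma> t))) \<longlongrightarrow> of_nat m) (at_right 1)"
    unfolding c by (simp add: algebra_simps)
  have 2: "((\<lambda>\<sigma>. of_real (\<sigma> - 1) / (Complex \<sigma> t - 1)) \<longlongrightarrow> (if t = 0 then 1 else 0)) (at_right 1)"
  proof (cases "t = 0")
    case True
    have "\<forall>\<^sub>F \<sigma> in at_right 1. of_real (\<sigma> - 1) / (Complex \<sigma> t - 1) = (1 :: complex)"
      unfolding c by (auto simp: True eventually_at intro!: exI[of _ 1])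
    then show ?thesis using True by (simp add: tendsto_eventually)
  next
    case False
    have "((\<lambda>\<sigma>. of_real (\<sigma> - 1) / (Complex \<sigma> t - 1)) \<longlongrightarrow> of_real (1 - 1) / (Complex 1 t - 1)) (at_right 1)"
      unfolding c using False by (intro tendsto_intros) auto
    then show ?thesis using False by simp
  qed
  have "\<forall>\<^sub>F \<sigma> in at_right 1. of_real (\<sigma> - 1) / (Complex \<sigma> t - 1)
      - of_real (\<sigma> - 1) * (deriv reg_zeta (Complex \<sigma> t) / reg_zeta (Complex \<sigma> t))
      = of_real (\<sigma> - 1) * mangoldt_series (Complex \<sigma> t)"
  proof (rule eventually_mono)
    show "\<forall>\<^sub>F \<sigma> in at_right 1. \<sigma> > (1 :: real)" by (simp add: eventually_at_filter)
    fix \<sigma> :: real assume "\<sigma> > 1"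
    then have s: "Re (Complex \<sigma> t) > 1" by simp
    show "of_real (\<sigma> - 1) / (Complex \<sigma> t - 1)
      - of_real (\<sigma> - 1) * (deriv reg_zeta (Complex \<sigma> t) / reg_zeta (Complex \<sigma> t))
      = of_real (\<sigma> - 1) * mangoldt_series (Complex \<sigma> t)"
      unfolding reg_zeta_deriv[OF s] nonzero_mult_div_cancel_left[OF reg_zeta_nonzero_gt_1[OF s]]
      by (simp add: right_diff_distrib)
  qed
  from Lim_transform_eventually[OF tendsto_diff[OF 2 1] this]
  have "((\<lambda>\<sigma>. of_real (\<sigma> - 1) * mangoldt_series (Complex \<sigma> t)) \<longlongrightarrow> (if t = 0 then 1 else 0) - of_nat m) (at_right 1)" .
  from tendsto_Re[OF this]
  have "((\<lambda>\<sigma>. (\<sigma> - 1) * Re (mangoldt_series (Complex \<sigma> t))) \<longlongrightarrow> (if t = 0 then 1 else 0) - real m) (at_right 1)"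
    by (cases "t = 0") simp_all
  then show thesis using that m(2) by blast
qed

lemma Re_mangoldt_series_sums:
  assumes "\<sigma> > 1"
  shows "(\<lambda>n. mangoldt (Suc n) * real (Suc n) powr - \<sigma> * cos (t * ln (real (Suc n)))) sums
           Re (mangoldt_series (Complex \<sigma> t))"
proof -
  have "(\<lambda>n. mangoldt (Suc n) * of_nat (Suc n) powr - Complex \<sigma> t) sums mangoldt_series (Complex \<sigma> t)"
    using mangoldt_series_sums[of "Complex \<sigma> t"] assms by (simp add: mangoldt_series_eq)
  from sums_Re[OF this] show ?thesis
  proof (rule sums_cong[THEN iffD1, rotated])
    fix n
    have "of_nat (Suc n) powr - Complex \<sigma> t = exp (- Complex \<sigma> t * of_real (ln (real (Suc n))))"
      using Ln_of_real[of "real (Suc n)"] by (simp add: powr_def del: of_nat_Suc)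
    then have "Re (of_nat (Suc n) powr - Complex \<sigma> t) = real (Suc n) powr - \<sigma> * cos (t * ln (real (Suc n)))"
      by (simp add: Re_exp powr_def)
    then have "Re (of_real (mangoldt (Suc n)) * of_nat (Suc n) powr - Complex \<sigma> t)
        = mangoldt (Suc n) * real (Suc n) powr - \<sigma> * cos (t * ln (real (Suc n)))"
      unfolding times_complex.sel by simp
    then show "Re (mangoldt (Suc n) * of_nat (Suc n) powr - Complex \<sigma> t)
        = mangoldt (Suc n) * real (Suc n) powr - \<sigma> * cos (t * ln (real (Suc n)))"
      by (simp only: of_real_mangoldt)
  qed
qed

lemma three_four_one:
  assumes "\<sigma> > 1"
  shows "0 \<le> 3 * Re (mangoldt_series (Complex \<sigma> 0)) + 4 * Re (mangoldt_series (Complex \<sigma> t))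
               + Re (mangoldt_series (Complex \<sigma> (2 * t)))"
proof (rule sums_le[OF _ sums_zero])
  let ?L = "\<lambda>n. ln (real (Suc n))" and ?c = "\<lambda>n. mangoldt (Suc n) * real (Suc n) powr - \<sigma>"
  show "(\<lambda>n. 3 * (?c n * cos (0 * ?L n)) + 4 * (?c n * cos (t * ?L n)) + ?c n * cos (2 * t * ?L n)) sums
      (3 * Re (mangoldt_series (Complex \<sigma> 0)) + 4 * Re (mangoldt_series (Complex \<sigma> t))
               + Re (mangoldt_series (Complex \<sigma> (2 * t))))"
    by (intro sums_add sums_mult Re_mangoldt_series_sums assms)
  fix n
  have "3 + 4 * cos (t * ?L n) + cos (2 * t * ?L n) = 2 * (1 + cos (t * ?L n))\<^sup>2"
    using cos_double_cos[of "t * ?L n"] by (simp add: power2_eq_square algebra_simps)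
  then have "0 \<le> ?c n * (3 + 4 * cos (t * ?L n) + cos (2 * t * ?L n))"
    by (simp add: mangoldt_nonneg)
  then show "0 \<le> 3 * (?c n * cos (0 * ?L n)) + 4 * (?c n * cos (t * ?L n)) + ?c n * cos (2 * t * ?L n)"
    by (simp add: algebra_simps)
qed

text \<open>Multiplying the 3-4-1 inequality by \<sigma> - 1 and letting \<sigma> tend to 1 gives 3
  (1 - k) - 4 m - l \<ge> 0, where k = 0 since \<open>reg_zeta 1 = 1\<close>. A zero at 1 + i t
  would make 4 m exceed 3.\<close>

lemma reg_zeta_nonzero:
  assumes "Re s \<ge> 1"
  shows "reg_zeta s \<noteq> 0"
proof (cases "Re s > 1 \<or> s = 1")
  case True
  then show ?thesis using reg_zeta_nonzero_gt_1 by auto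
next
  case False
  define t where "t = Im s"
  have s: "s = Complex 1 t" and "t \<noteq> 0"
    using False assms by (auto simp: t_def complex_eq_iff)
  obtain k :: nat where k: "((\<lambda>\<sigma>. (\<sigma> - 1) * Re (mangoldt_series (Complex \<sigma> 0))) \<longlongrightarrow>
        (if (0 :: real) = 0 then 1 else 0) - real k) (at_right 1)" "k = 0 \<longleftrightarrow> reg_zeta (Complex 1 0) \<noteq> 0"
    by (rule mangoldt_series_limit)
  obtain m :: nat where m: "((\<lambda>\<sigma>. (\<sigma> - 1) * Re (mangoldt_series (Complex \<sigma> t))) \<longlongrightarrow>
        (if t = 0 then 1 else 0) - real m) (at_right 1)" "m = 0 \<longleftrightarrow> reg_zeta (Complex 1 t) \<noteq> 0"
    by (rule mangoldt_series_limit)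
  obtain l :: nat where l: "((\<lambda>\<sigma>. (\<sigma> - 1) * Re (mangoldt_series (Complex \<sigma> (2 * t)))) \<longlongrightarrow>
        (if 2 * t = 0 then 1 else 0) - real l) (at_right 1)"
    by (rule mangoldt_series_limit)
  have "Complex 1 0 = 1" by (simp add: complex_eq_iff)
  then have "k = 0" using k(2) by simp
  have "0 \<le> 3 * ((if (0 :: real) = 0 then 1 else 0) - real k) + 4 * ((if t = 0 then 1 else 0) - real m)
      + ((if 2 * t = 0 then 1 else 0) - real l)" (is "0 \<le> ?lim")
  proof (rule tendsto_lowerbound)
    show "((\<lambda>\<sigma>. 3 * ((\<sigma> - 1) * Re (mangoldt_series (Complex \<sigma> 0))) + 4 * ((\<sigma> - 1) * Re (mangoldt_series (Complex \<sigma> t)))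
        + (\<sigma> - 1) * Re (mangoldt_series (Complex \<sigma> (2 * t)))) \<longlongrightarrow> ?lim) (at_right 1)"
      by (intro tendsto_intros k m l)
    show "\<forall>\<^sub>F \<sigma> in at_right 1. 0 \<le> 3 * ((\<sigma> - 1) * Re (mangoldt_series (Complex \<sigma> 0)))
        + 4 * ((\<sigma> - 1) * Re (mangoldt_series (Complex \<sigma> t))) + (\<sigma> - 1) * Re (mangoldt_series (Complex \<sigma> (2 * t)))"
    proof (rule eventually_mono)
      show "\<forall>\<^sub>F \<sigma> in at_right 1. \<sigma> > (1 :: real)" by (simp add: eventually_at_filter)
      fix \<sigma> :: real assume "\<sigma> > 1"
      then have "0 \<le> (\<sigma> - 1) * (3 * Re (mangoldt_series (Complex \<sigma> 0)) + 4 * Re (mangoldt_series (Complex \<sigma> t))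
               + Re (mangoldt_series (Complex \<sigma> (2 * t))))"
        using three_four_one[of \<sigma> t] by simp
      then show "0 \<le> 3 * ((\<sigma> - 1) * Re (mangoldt_series (Complex \<sigma> 0)))
        + 4 * ((\<sigma> - 1) * Re (mangoldt_series (Complex \<sigma> t))) + (\<sigma> - 1) * Re (mangoldt_series (Complex \<sigma> (2 * t)))"
        by (simp only: distrib_left mult.left_commute)
    qed
  qed simp
  then have "m = 0" using \<open>k = 0\<close> \<open>t \<noteq> 0\<close> by simp
  then show ?thesis using m(2) s by simp
qed

section \<open>Newman's Tauberian theorem\<close>

text \<open>The power tends to 0 pointwise where Re w < 0 but not uniformly near the imaginary axis,
  so dominated convergence is used, with the power bounded by 1. The alternative with f w = 0 admits
  segments that end on the axis.\<close>

lemma linepath_contour_integral_tendsto_0: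
  assumes f: "continuous_on (closed_segment a b) f"
    and Re: "\<And>w. w \<in> closed_segment a b \<Longrightarrow> Re w < 0 \<or> Re w = 0 \<and> f w = 0"
  shows "(\<lambda>N. contour_integral (linepath a b) (\<lambda>w. f w * of_nat (Suc N) powr w)) \<longlonglongrightarrow> 0"
proof -
  let ?F = "\<lambda>N t. f (linepath a b t) * of_nat (Suc N) powr (linepath a b t) * (b - a)"
  have seg: "linepath a b t \<in> closed_segment a b" if "t \<in> {0..1}" for t
    using that linepath_in_path by blast
  have contf: "continuous_on {0..1} (\<lambda>t. f (linepath a b t))"
    by (rule continuous_on_compose2[OF f]) (auto intro: seg continuous_intros)
  have "compact (f ` closed_segment a b)"
    by (intro compact_continuous_image f compact_segment)
  then obtain M where M: "\<And>w. w \<in> closed_segment a b \<Longrightarrow> norm (f w) \<le> M"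
    by (meson bounded_iff compact_imp_bounded imageI)
  have "(\<lambda>N. integral {0..1} (?F N)) \<longlonglongrightarrow> integral {0..1::real} (\<lambda>_. 0)"
  proof (rule dominated_convergence(2))
    show "?F N integrable_on {0..1}" for N
      by (intro integrable_continuous_real continuous_intros contf) (auto simp del: of_nat_Suc)
    show "(\<lambda>_. M * norm (b - a)) integrable_on {0..1::real}" by auto
    fix t :: real assume t: "t \<in> {0..1}"
    note w = seg[OF t]
    show "norm (?F N t) \<le> M * norm (b - a)" for N
    proof -
      have "norm (of_nat (Suc N) powr linepath a b t :: complex) \<le> real (Suc N) powr 0"
        unfolding norm_powr_Suc using Re[OF w] by (intro powr_mono) auto
      then have "norm (f (linepath a b t)) * norm (of_nat (Suc N) powr linepath a b t :: complex) \<le> M * 1"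
        using M[OF w] order_trans[OF norm_ge_zero M[OF w]] by (intro mult_mono) auto
      then show ?thesis
        unfolding norm_mult by (intro mult_right_mono) auto
    qed
    show "(\<lambda>N. ?F N t) \<longlonglongrightarrow> 0"
    proof (cases "Re (linepath a b t) < 0")
      case True
      then show ?thesis
        by (intro tendsto_mult_left_zero tendsto_mult_right_zero tendsto_nat_powr_0[OF True])
    next
      case False
      then show ?thesis using Re[OF w] by simp
    qed
  qed
  then show ?thesis
    by (simp add: contour_integral_integral vector_derivative_linepath_within)
qed

text \<open>Each arc has its own primitive of 1/w, the principal logarithm of w on the first and of
  -w on the second, and each contributes i pi. No particular shape of the arcs is involved, so this
  serves both contours of Newman's argument.\<close>

lemma winding_number_two_arcs:
  assumes g1: "valid_path g1" "pathstart g1 = - \<i> * of_real R" "pathfinish g1 = \<i> * of_real R" "path_image g1 \<subseteq> - \<real>\<^sub>\<le>\<^sub>0"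
    and g2: "valid_path g2" "pathstart g2 = \<i> * of_real R" "pathfinish g2 = - \<i> * of_real R" "path_image g2 \<subseteq> - \<real>\<^sub>\<ge>\<^sub>0"
    and R: "R > 0"
  shows "winding_number (g1 +++ g2) 0 = 1"
proof -
  have L: "Ln (\<i> * of_real R) - Ln (- \<i> * of_real R) = \<i> * of_real pi"
    using R Ln_times_of_real[of R \<i>] Ln_times_of_real[of R "- \<i>"] by (simp add: mult.commute)
  have "((\<lambda>w. 1 / w) has_contour_integral Ln (pathfinish g1) - Ln (pathstart g1)) g1"
    by (rule contour_integral_primitive[where S = "- \<real>\<^sub>\<le>\<^sub>0"])
       (use g1 in \<open>auto intro!: derivative_eq_intros simp: field_simps\<close>)
  moreover have "((\<lambda>w. 1 / w) has_contour_integral Ln (- pathfinish g2) - Ln (- pathstart g2)) g2"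
  proof (rule contour_integral_primitive[where S = "- \<real>\<^sub>\<ge>\<^sub>0"])
    fix x :: complex assume "x \<in> - \<real>\<^sub>\<ge>\<^sub>0"
    then have "- x \<notin> \<real>\<^sub>\<le>\<^sub>0" by (auto simp: complex_nonpos_Reals_iff complex_nonneg_Reals_iff)
    moreover have "x \<noteq> 0" using \<open>x \<in> _\<close> by auto
    ultimately show "((\<lambda>x. Ln (- x)) has_field_derivative 1 / x) (at x within - \<real>\<^sub>\<ge>\<^sub>0)"
      by (auto intro!: derivative_eq_intros simp: field_simps)
  qed (use g2 in auto)
  ultimately have "((\<lambda>w. 1 / w) has_contour_integral \<i> * of_real pi + \<i> * of_real pi) (g1 +++ g2)"
    using g1 g2 L by (intro has_contour_integral_join) auto
  moreover have "valid_path (g1 +++ g2)" "0 \<notin> path_image (g1 +++ g2)"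
    using g1 g2 by (auto simp: path_image_join)
  ultimately show ?thesis
    by (simp add: winding_number_valid_path contour_integral_unique)
qed

text \<open>The two halves are kept as separate integrals so that formulas with a common right half
  can be subtracted.\<close>

lemma Cauchy_two_arcs:
  assumes g1: "valid_path g1" "pathstart g1 = - \<i> * of_real R" "pathfinish g1 = \<i> * of_real R"
      "path_image g1 \<subseteq> V - \<real>\<^sub>\<le>\<^sub>0"
    and g2: "valid_path g2" "pathstart g2 = \<i> * of_real R" "pathfinish g2 = - \<i> * of_real R"
      "path_image g2 \<subseteq> V - \<real>\<^sub>\<ge>\<^sub>0"
    and R: "R > 0" and V: "convex V" "open V" "0 \<in> V" and f: "f holomorphic_on V"
  shows "contour_integral g1 (\<lambda>w. f w / w) + contour_integral g2 (\<lambda>w. f w / w) = 2 * of_real pi * \<i> * f 0"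
proof -
  have "winding_number (g1 +++ g2) 0 = 1"
    by (rule winding_number_two_arcs[of _ R]) (use g1 g2 R in auto)
  moreover have "((\<lambda>w. f w / (w - 0)) has_contour_integral
      (2 * pi * \<i> * winding_number (g1 +++ g2) 0 * f 0)) (g1 +++ g2)"
    by (rule Cauchy_integral_formula_convex_simple[of V])
       (use g1 g2 V f in \<open>auto simp: path_image_join interior_open\<close>)
  ultimately have I: "((\<lambda>w. f w / w) has_contour_integral 2 * of_real pi * \<i> * f 0) (g1 +++ g2)"
    by simp
  have "(\<lambda>w. f w / w) contour_integrable_on g" if "valid_path g" "path_image g \<subseteq> V - {0}" for g
    using that f V by (intro contour_integrable_holomorphic_simple[of _ "V - {0}"] holomorphic_intros)
      (auto intro: holomorphic_on_subset)
  then have "(\<lambda>w. f w / w) contour_integrable_on g1" "(\<lambda>w. f w / w) contour_integrable_on g2"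
    using g1(1,4) g2(1,4) nonpos_Reals_zero_I nonneg_Reals_zero_I by blast+
  then show ?thesis
    using contour_integral_unique[OF I] g1 g2 by (simp add: contour_integral_join)
qed

text \<open>On the circle R^2 = w * cnj w, so the kernel is the real number (w + cnj w) / R^2 = 2 Re
  w / R^2.\<close>

lemma norm_Newman_kernel:
  assumes "norm w = R" "R > 0"
  shows "norm ((1 + w\<^sup>2 / of_real (R\<^sup>2)) / w) = 2 * \<bar>Re w\<bar> / R\<^sup>2"
proof -
  have "of_real (R\<^sup>2) = w * cnj w"
    using assms complex_norm_square[of w] by simp
  then have "of_real (R\<^sup>2) + w\<^sup>2 = w * of_real (2 * Re w)"
    unfolding complex_add_cnj[symmetric] by (simp add: power2_eq_square algebra_simps)
  moreover have "(1 + w\<^sup>2 / of_real (R\<^sup>2)) / w = (of_real (R\<^sup>2) + w\<^sup>2) / w / of_real (R\<^sup>2)"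
    using assms by (simp add: field_simps)
  moreover have "w \<noteq> 0" using assms by auto
  ultimately have "(1 + w\<^sup>2 / of_real (R\<^sup>2)) / w = of_real (2 * Re w / R\<^sup>2)"
    by simp
  then show ?thesis by (simp only: norm_of_real) (simp add: abs_mult)
qed

text \<open>The variable is w = s - 1, so the critical line is the imaginary axis.
  \<open>bound\<close> holds on both sides of it: it controls partial sums on the left and tails on
  the right.\<close>

locale Newman =
  fixes h :: "nat \<Rightarrow> complex \<Rightarrow> complex" and g :: "complex \<Rightarrow> complex" and U :: "complex set" and B :: real
  assumes U: "open U" "{w. Re w \<ge> 0} \<subseteq> U" and g: "g holomorphic_on U"
    and h: "\<And>n. h n holomorphic_on UNIV"
    and bound: "\<And>n w. Re w \<noteq> 0 \<Longrightarrow>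
      norm (h n w) \<le> B * ((real (Suc n) powr - Re w - real (Suc (Suc n)) powr - Re w) / Re w)"
    and sums: "\<And>w. Re w > 0 \<Longrightarrow> (\<lambda>n. h n w) sums g w"
begin

definition G :: "nat \<Rightarrow> complex \<Rightarrow> complex" where "G N w = (\<Sum>n<N. h n w)"

lemma B_nonneg: "B \<ge> 0"
proof -
  have "norm (h 0 1) \<le> B * (1 - real (Suc (Suc 0)) powr - 1)"
    using bound[of 1 0] by simp
  from order_trans[OF norm_ge_zero this]
  show ?thesis by (simp add: powr_minus zero_le_mult_iff)
qed

lemma G_holomorphic: "G N holomorphic_on S"
  unfolding G_def[abs_def] by (intro holomorphic_on_sum holomorphic_on_subset[OF h]) auto

text \<open>The bounds on the single terms telescope. Letting M tend to infinity for Re w > 0, or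
  taking N = 0 for Re w < 0, bounds the tail and the partial sum alike by B (N + 1)^(- Re w) / |Re
  w|.\<close>

lemma norm_G_diff_le:
  assumes "N \<le> M" "Re w \<noteq> 0"
  shows "norm (G M w - G N w) \<le> B * ((real (Suc N) powr - Re w - real (Suc M) powr - Re w) / Re w)"
  using assms(1)
proof (induction M rule: dec_induct)
  case base
  then show ?case by simp
next
  case (step M)
  have "norm (G (Suc M) w - G N w) \<le> norm (G M w - G N w) + norm (h M w)"
    using norm_triangle_ineq[of "G M w - G N w" "h M w"] by (simp add: G_def algebra_simps)
  also have "\<dots> \<le> B * ((real (Suc N) powr - Re w - real (Suc M) powr - Re w) / Re w)
      + B * ((real (Suc M) powr - Re w - real (Suc (Suc M)) powr - Re w) / Re w)"
    by (intro add_mono step.IH bound assms)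
  also have "\<dots> = B * ((real (Suc N) powr - Re w - real (Suc (Suc M)) powr - Re w) / Re w)"
    by (simp add: diff_divide_distrib algebra_simps)
  finally show ?case .
qed

lemma norm_tail_le:
  assumes "Re w > 0"
  shows "norm (g w - G N w) \<le> B * real (Suc N) powr - Re w / Re w"
proof (rule tendsto_upperbound)
  have "(\<lambda>M. G M w) \<longlonglongrightarrow> g w"
    using sums[OF assms] by (simp add: sums_def G_def)
  then show "(\<lambda>M. norm (G M w - G N w)) \<longlonglongrightarrow> norm (g w - G N w)"
    by (intro tendsto_intros)
  show "\<forall>\<^sub>F M in sequentially. norm (G M w - G N w) \<le> B * real (Suc N) powr - Re w / Re w"
  proof (rule eventually_sequentiallyI[of N])
    fix M assume "N \<le> M"
    then have "norm (G M w - G N w) \<le> B * ((real (Suc N) powr - Re w - real (Suc M) powr - Re w) / Re w)"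
      using assms by (intro norm_G_diff_le) auto
    also have "\<dots> \<le> B * (real (Suc N) powr - Re w / Re w)"
      using assms by (intro mult_left_mono divide_right_mono B_nonneg) auto
    finally show "norm (G M w - G N w) \<le> B * real (Suc N) powr - Re w / Re w" by simp
  qed
qed simp

lemma norm_G_le:
  assumes "Re w < 0"
  shows "norm (G N w) \<le> B * real (Suc N) powr - Re w / \<bar>Re w\<bar>"
proof -
  have "norm (G N w) \<le> B * ((1 - real (Suc N) powr - Re w) / Re w)"
    using norm_G_diff_le[of 0 N w] assms by (simp add: G_def)
  also have "\<dots> \<le> B * (real (Suc N) powr - Re w / \<bar>Re w\<bar>)"
    using assms by (intro mult_left_mono B_nonneg) (simp add: field_simps)
  finally show ?thesis by simp
qed

text \<open>On the circle of radius \<open>R\<close> the quadratic factor is of size \<open>2 \<bar>Re w\<bar> / R\<close>, which cancels the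
  singularity of the bounds on \<open>G\<close> and on the tail at the imaginary axis; the power of \<open>N\<close> cancels their growth.\<close>

definition K :: "real \<Rightarrow> nat \<Rightarrow> complex \<Rightarrow> complex" where
  "K R N w = of_nat (Suc N) powr w * (1 + w\<^sup>2 / of_real (R\<^sup>2))"

lemma K_0 [simp]: "K R N 0 = 1"
  by (simp add: K_def del: of_nat_Suc)

lemma K_holomorphic: "R > 0 \<Longrightarrow> K R N holomorphic_on S"
  unfolding K_def[abs_def] by (intro holomorphic_intros) (auto simp del: of_nat_Suc)

lemma norm_K_mult_le:
  assumes "norm w = R" "R > 0" "Re w \<noteq> 0" "norm x \<le> B * real (Suc N) powr - Re w / \<bar>Re w\<bar>"
  shows "norm (x * K R N w / w) \<le> 2 * B / R\<^sup>2"
proof -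
  have "norm (x * K R N w / w) = norm x * (real (Suc N) powr Re w * norm ((1 + w\<^sup>2 / of_real (R\<^sup>2)) / w))"
    by (simp only: K_def norm_mult norm_divide norm_powr_Suc times_divide_eq_right mult.assoc)
  also have "\<dots> \<le> B * real (Suc N) powr - Re w / \<bar>Re w\<bar> * (real (Suc N) powr Re w * (2 * \<bar>Re w\<bar> / R\<^sup>2))"
    unfolding norm_Newman_kernel[OF assms(1,2)] using assms by (intro mult_right_mono) auto
  also have "\<dots> = 2 * B / R\<^sup>2 * (real (Suc N) powr - Re w * real (Suc N) powr Re w)"
    using assms(3) by (simp add: field_simps)
  also have "real (Suc N) powr - Re w * real (Suc N) powr Re w = 1"
    by (simp flip: powr_add)
  finally show ?thesis by simp
qed

text \<open>Both \<open>g 0\<close> and \<open>G N 0\<close> are Cauchy integrals with the kernel \<open>K R N w / w\<close> and share the right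
  half \<open>cp\<close> of the contour. On the left, the entire function \<open>G N\<close> is integrated over the other half \<open>cm\<close>
  of the circle, whereas for \<open>g\<close> the path \<open>q\<close> must stay in a thin strip around the imaginary axis, where
  \<open>g\<close> is holomorphic; its contribution \<open>e N\<close> vanishes in the limit because the kernel decays there.\<close>

lemma norm_diff_le:
  assumes "R > 0"
  obtains e where "e \<longlonglongrightarrow> 0" "\<And>N. norm (g 0 - G N 0) \<le> 2 * B / R + norm (e N :: complex)"
proof -
  \<comment> \<open>Compactness of this rectangle yields one width d by which U extends to the left
    of it. This d depends on R, which is why N must tend to infinity with R fixed.\<close>
  define S where "S = cbox (Complex 0 (- (R + 1))) (Complex (R + 1) (R + 1))"
  have "S \<subseteq> U" using U(2) by (auto simp: S_def in_cbox_complex_iff)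
  then obtain d where d: "d > 0" "(\<Union>x\<in>S. ball x d) \<subseteq> U"
    using compact_subset_open_imp_ball_epsilon_subset[of S U] U by (auto simp: S_def)
  define V where "V = box (Complex (- d) (- (R + 1))) (Complex (R + 1) (R + 1))"
  have "V \<subseteq> U"
  proof
    fix w assume w: "w \<in> V"
    show "w \<in> U"
    proof (cases "Re w \<ge> 0")
      case True
      then show ?thesis using U by auto
    next
      case False
      have "w - Complex 0 (Im w) = of_real (Re w)" by (simp add: complex_eq_iff)
      then have "dist (Complex 0 (Im w)) w = \<bar>Re w\<bar>"
        by (metis dist_commute dist_norm norm_of_real)
      then have "w \<in> ball (Complex 0 (Im w)) d" "Complex 0 (Im w) \<in> S"
        using w False assms by (auto simp: V_def S_def in_box_complex_iff in_cbox_complex_iff)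
      then show ?thesis using d by blast
    qed
  qed
  then have gV: "g holomorphic_on V" using g holomorphic_on_subset by blast
  have V: "convex V" "open V" "0 \<in> V"
    using d assms by (auto simp: V_def in_box_complex_iff convex_box open_box)

  define cp where "cp = part_circlepath 0 R (- pi / 2) (pi / 2)"
  define cm where "cm = part_circlepath 0 R (pi / 2) (3 * pi / 2)"
  \<comment> \<open>Abscissa - d / 2, half the available width, keeps the left side inside V and
    strictly left of the axis.\<close>
  define p1 p2 where "p1 = Complex (- d / 2) R" and "p2 = Complex (- d / 2) (- R)"
  define q where "q = linepath (\<i> * of_real R) p1 +++ linepath p1 p2 +++ linepath p2 (- \<i> * of_real R)"

  have cp_img: "norm w = R \<and> Re w \<ge> 0" if "w \<in> path_image cp" for w
    using that assms
    by (auto simp: cp_def path_image_part_circlepath' norm_mult closed_segment_eq_real_ivl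
        intro!: mult_nonneg_nonneg cos_ge_zero)
  have cm_img: "norm w = R \<and> Re w \<le> 0" if w: "w \<in> path_image cm" for w
  proof -
    obtain x where x: "pi / 2 \<le> x" "x \<le> 3 * pi / 2" "w = of_real R * cis x"
      using w by (auto simp: cm_def path_image_part_circlepath' closed_segment_eq_real_ivl)
    then have "cos (x - pi) \<ge> 0" by (intro cos_ge_zero) auto
    then show ?thesis using x assms by (auto simp: norm_mult mult_le_0_iff)
  qed
  \<comment> \<open>The path meets the imaginary axis only at \<i> R and - \<i> R, where w^2 = - R^2
    and the factor 1 + w^2 / R^2 vanishes.\<close>
  have q_img: "w \<in> V \<and> w \<notin> \<real>\<^sub>\<ge>\<^sub>0 \<and> (Re w < 0 \<or> Re w = 0 \<and> \<bar>Im w\<bar> = R)"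
    if "w \<in> closed_segment (\<i> * of_real R) p1 \<union> closed_segment p1 p2 \<union> closed_segment p2 (- \<i> * of_real R)" for w
    using that assms d(1)
    by (auto simp: p1_def p2_def closed_segment_same_Re closed_segment_same_Im closed_segment_eq_real_ivl
          V_def in_box_complex_iff complex_nonneg_Reals_iff)
  have valid: "valid_path cp" "valid_path cm" "valid_path q"
    by (auto simp: cp_def cm_def q_def)
  have "cis (3 * pi / 2) = - \<i>"
    using cos_periodic_pi[of "pi / 2"] sin_periodic_pi[of "pi / 2"] by (simp add: complex_eq_iff field_simps)
  moreover have "cis (- pi / 2) = - \<i>" "cis (pi / 2) = \<i>"
    by (simp_all add: complex_eq_iff)
  moreover have "pathstart (part_circlepath 0 R s t) = of_real R * cis s"
      "pathfinish (part_circlepath 0 R s t) = of_real R * cis t" for s t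
    by (simp_all add: cis_conv_exp)
  ultimately have ends: "pathstart cp = - \<i> * of_real R" "pathfinish cp = \<i> * of_real R"
      "pathstart cm = \<i> * of_real R" "pathfinish cm = - \<i> * of_real R"
      "pathstart q = \<i> * of_real R" "pathfinish q = - \<i> * of_real R"
    unfolding cp_def cm_def q_def by (simp_all only:) simp_all
  have q_path: "path_image q \<subseteq> V - \<real>\<^sub>\<ge>\<^sub>0"
    using q_img unfolding q_def by (force simp: path_image_join)
  have cp_nonpos: "path_image cp \<inter> \<real>\<^sub>\<le>\<^sub>0 = {}"
    using cp_img assms by (force simp: complex_nonpos_Reals_iff complex_eq_iff)
  have cm_nonneg: "path_image cm \<inter> \<real>\<^sub>\<ge>\<^sub>0 = {}"
    using cm_img assms by (force simp: complex_nonneg_Reals_iff complex_eq_iff)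
  have "path_image cp \<subseteq> V"
  proof
    fix w assume "w \<in> path_image cp"
    then show "w \<in> V"
      using cp_img[of w] assms d(1) abs_Re_le_cmod[of w] abs_Im_le_cmod[of w]
      by (auto simp: V_def in_box_complex_iff)
  qed

  define e where "e = (\<lambda>N. contour_integral q (\<lambda>w. g w * K R N w / w) / of_real (2 * pi))"
  have "(\<lambda>N. contour_integral q (\<lambda>w. g w * K R N w / w)) \<longlonglongrightarrow> 0 + (0 + 0)"
  proof -
    define f where "f = (\<lambda>w. g w * (1 + w\<^sup>2 / of_real (R\<^sup>2)) / w)"
    have f_eq: "(\<lambda>w. g w * K R N w / w) = (\<lambda>w. f w * of_nat (Suc N) powr w)" for N
      by (simp add: fun_eq_iff f_def K_def mult_ac)
    have f_cont: "continuous_on (V - {0}) f"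
      unfolding f_def using assms gV
      by (intro continuous_intros holomorphic_on_imp_continuous_on) (auto intro: holomorphic_on_subset)
    have f_zero: "Re w < 0 \<or> Re w = 0 \<and> f w = 0"
      if "Re w < 0 \<or> Re w = 0 \<and> \<bar>Im w\<bar> = R" for w
    proof (cases "Re w < 0")
      case False
      then have "w = \<i> * of_real R \<or> w = - \<i> * of_real R" using that by (auto simp: complex_eq_iff abs_if split: if_splits)
      then have "w\<^sup>2 = - of_real (R\<^sup>2)" by (auto simp: power_mult_distrib)
      then show ?thesis using that assms by (auto simp: f_def)
    qed auto
    have seg: "(\<lambda>N. contour_integral (linepath a b) (\<lambda>w. f w * of_nat (Suc N) powr w)) \<longlonglongrightarrow> 0"
        "(\<lambda>w. f w * of_nat (Suc N) powr w) contour_integrable_on linepath a b"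
      if ab: "\<And>w. w \<in> closed_segment a b \<Longrightarrow> w \<in> V \<and> w \<notin> \<real>\<^sub>\<ge>\<^sub>0 \<and> (Re w < 0 \<or> Re w = 0 \<and> \<bar>Im w\<bar> = R)" for a b N
    proof -
      have "closed_segment a b \<subseteq> V - {0}" using ab by (metis DiffI singletonD subsetI nonneg_Reals_zero_I)
      then have c: "continuous_on (closed_segment a b) f" using f_cont continuous_on_subset by blast
      show "(\<lambda>N. contour_integral (linepath a b) (\<lambda>w. f w * of_nat (Suc N) powr w)) \<longlonglongrightarrow> 0"
        using ab f_zero by (intro linepath_contour_integral_tendsto_0 c) blast
      show "(\<lambda>w. f w * of_nat (Suc N) powr w) contour_integrable_on linepath a b"
        by (intro contour_integrable_continuous_linepath continuous_intros c) (auto simp del: of_nat_Suc)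
    qed
    have segs: "\<And>w. w \<in> closed_segment (\<i> * of_real R) p1 \<Longrightarrow> w \<in> V \<and> w \<notin> \<real>\<^sub>\<ge>\<^sub>0 \<and> (Re w < 0 \<or> Re w = 0 \<and> \<bar>Im w\<bar> = R)"
        "\<And>w. w \<in> closed_segment p1 p2 \<Longrightarrow> w \<in> V \<and> w \<notin> \<real>\<^sub>\<ge>\<^sub>0 \<and> (Re w < 0 \<or> Re w = 0 \<and> \<bar>Im w\<bar> = R)"
        "\<And>w. w \<in> closed_segment p2 (- \<i> * of_real R) \<Longrightarrow> w \<in> V \<and> w \<notin> \<real>\<^sub>\<ge>\<^sub>0 \<and> (Re w < 0 \<or> Re w = 0 \<and> \<bar>Im w\<bar> = R)"
      using q_img by blast+
    have "contour_integral q (\<lambda>w. f w * of_nat (Suc N) powr w) =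
        contour_integral (linepath (\<i> * of_real R) p1) (\<lambda>w. f w * of_nat (Suc N) powr w) +
        (contour_integral (linepath p1 p2) (\<lambda>w. f w * of_nat (Suc N) powr w) +
         contour_integral (linepath p2 (- \<i> * of_real R)) (\<lambda>w. f w * of_nat (Suc N) powr w))" for N
      unfolding q_def using seg(2)[OF segs(1)] seg(2)[OF segs(2)] seg(2)[OF segs(3)]
      by (simp del: of_nat_Suc)
    then show ?thesis
      unfolding f_eq by (simp only:) (intro tendsto_add seg(1) segs; assumption)
  qed
  then have "e \<longlonglongrightarrow> 0"
    unfolding e_def by (auto intro!: tendsto_eq_intros)
  moreover have "norm (g 0 - G N 0) \<le> 2 * B / R + norm (e N)" for N
  proof -
    have integrable: "(\<lambda>w. f w * K R N w / w) contour_integrable_on p"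
      if "valid_path p" "path_image p \<subseteq> S - {0}" "f holomorphic_on S" "open S" for p f S
      using that assms by (intro contour_integrable_holomorphic_simple[of _ "S - {0}"] holomorphic_intros K_holomorphic)
        (auto intro: holomorphic_on_subset)
    have cp0: "path_image cp \<subseteq> V - {0}" "path_image cp \<subseteq> UNIV - {0}" "path_image cm \<subseteq> UNIV - {0}"
      using cp_img[of 0] cm_img[of 0] assms \<open>path_image cp \<subseteq> V\<close> by auto
    have int: "(\<lambda>w. g w * K R N w / w) contour_integrable_on cp"
        "(\<lambda>w. G N w * K R N w / w) contour_integrable_on cp"
        "(\<lambda>w. G N w * K R N w / w) contour_integrable_on cm"
      by (rule integrable[OF valid(1) cp0(1) gV V(2)]
            integrable[OF valid(1) cp0(2) G_holomorphic open_UNIV] integrable[OF valid(2) cp0(3) G_holomorphic open_UNIV])+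
    have g0: "contour_integral cp (\<lambda>w. g w * K R N w / w) + contour_integral q (\<lambda>w. g w * K R N w / w)
        = 2 * of_real pi * \<i> * (g 0 * K R N 0)"
      using \<open>path_image cp \<subseteq> V\<close> cp_nonpos q_path valid ends V gV assms
      by (intro Cauchy_two_arcs[where V = V and R = R] holomorphic_intros K_holomorphic) auto
    have G0: "contour_integral cp (\<lambda>w. G N w * K R N w / w) + contour_integral cm (\<lambda>w. G N w * K R N w / w)
        = 2 * of_real pi * \<i> * (G N 0 * K R N 0)"
      using cp_nonpos cm_nonneg valid ends assms
      by (intro Cauchy_two_arcs[where V = UNIV and R = R] holomorphic_intros K_holomorphic G_holomorphic) auto
    have diff: "contour_integral cp (\<lambda>w. (g w - G N w) * K R N w / w)
        = contour_integral cp (\<lambda>w. g w * K R N w / w) - contour_integral cp (\<lambda>w. G N w * K R N w / w)"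
      using contour_integral_diff[OF int(1,2)] by (simp add: left_diff_distrib diff_divide_distrib)
    have "2 * of_real pi * \<i> * (g 0 - G N 0) = contour_integral cp (\<lambda>w. (g w - G N w) * K R N w / w)
        + contour_integral q (\<lambda>w. g w * K R N w / w) - contour_integral cm (\<lambda>w. G N w * K R N w / w)"
      using g0 G0 unfolding diff K_0 by (simp add: algebra_simps)
    then have "norm (2 * of_real pi * \<i> * (g 0 - G N 0)) \<le> norm (contour_integral cp (\<lambda>w. (g w - G N w) * K R N w / w))
        + norm (contour_integral q (\<lambda>w. g w * K R N w / w)) + norm (contour_integral cm (\<lambda>w. G N w * K R N w / w))"
      by (metis (no_types, lifting) norm_triangle_ineq norm_triangle_ineq4 order_trans add_right_mono)
    moreover have "norm (contour_integral cp (\<lambda>w. (g w - G N w) * K R N w / w)) \<le> 2 * B / R\<^sup>2 * R * (pi / 2 - - pi / 2)"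
      unfolding cp_def
    \<comment> \<open>The finite exceptional set \<open>k\<close> removes the two ends of the arc,
      where Re w = 0 and the bound with 1 / |Re w| says nothing.\<close>
    proof (rule contour_integral_bound_part_circlepath_strong[where k = "{\<i> * of_real R, - \<i> * of_real R}"])
      show "(\<lambda>w. (g w - G N w) * K R N w / w) contour_integrable_on part_circlepath 0 R (- pi / 2) (pi / 2)"
        using contour_integrable_diff[OF int(1,2)] by (simp add: cp_def left_diff_distrib diff_divide_distrib)
      fix w assume w: "w \<in> path_image (part_circlepath 0 R (- pi / 2) (pi / 2)) - {\<i> * of_real R, - \<i> * of_real R}"
      then have nw: "norm w = R" "Re w \<ge> 0" using cp_img by (auto simp: cp_def)
      have "Re w \<noteq> 0"
      proof
        assume "Re w = 0"
        then have "\<bar>Im w\<bar> = R" using nw by (simp add: norm_complex_def)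
        then show False using w \<open>Re w = 0\<close> by (auto simp: complex_eq_iff abs_if split: if_splits)
      qed
      then show "norm ((g w - G N w) * K R N w / w) \<le> 2 * B / R\<^sup>2"
        using nw norm_tail_le[of w N] assms by (intro norm_K_mult_le) auto
    qed (use assms B_nonneg in auto)
    moreover have "norm (contour_integral cm (\<lambda>w. G N w * K R N w / w)) \<le> 2 * B / R\<^sup>2 * R * (3 * pi / 2 - pi / 2)"
      unfolding cm_def
    proof (rule contour_integral_bound_part_circlepath_strong[where k = "{\<i> * of_real R, - \<i> * of_real R}"])
      show "(\<lambda>w. G N w * K R N w / w) contour_integrable_on part_circlepath 0 R (pi / 2) (3 * pi / 2)"
        using int(3) by (simp add: cm_def)
      fix w assume w: "w \<in> path_image (part_circlepath 0 R (pi / 2) (3 * pi / 2)) - {\<i> * of_real R, - \<i> * of_real R}"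
      then have nw: "norm w = R" "Re w \<le> 0" using cm_img by (auto simp: cm_def)
      have "Re w \<noteq> 0"
      proof
        assume "Re w = 0"
        then have "\<bar>Im w\<bar> = R" using nw by (simp add: norm_complex_def)
        then show False using w \<open>Re w = 0\<close> by (auto simp: complex_eq_iff abs_if split: if_splits)
      qed
      then show "norm (G N w * K R N w / w) \<le> 2 * B / R\<^sup>2"
        using nw norm_G_le[of w N] assms by (intro norm_K_mult_le) auto
    qed (use assms B_nonneg in auto)
    moreover have "norm (contour_integral q (\<lambda>w. g w * K R N w / w)) = 2 * pi * norm (e N)"
      by (simp add: e_def norm_divide)
    \<comment> \<open>Each half circle has length pi R and an integrand of size at most 2 B / R^2;
      two of them, divided by 2 pi, make 2 B / R.\<close>
    moreover have "2 * B / R\<^sup>2 * R * (pi / 2 - - pi / 2) = 2 * pi * (B / R)" "2 * B / R\<^sup>2 * R * (3 * pi / 2 - pi / 2) = 2 * pi * (B / R)"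
      using assms by (simp_all add: power2_eq_square field_simps)
    moreover have "norm (2 * of_real pi * \<i> * (g 0 - G N 0)) = 2 * pi * norm (g 0 - G N 0)"
      by (simp add: norm_mult)
    ultimately have "2 * pi * norm (g 0 - G N 0) \<le> 2 * pi * (B / R) + 2 * pi * norm (e N) + 2 * pi * (B / R)"
      by linarith
    also have "\<dots> = 2 * pi * (2 * B / R + norm (e N))"
      by (simp add: algebra_simps)
    finally have "2 * pi * norm (g 0 - G N 0) \<le> 2 * pi * (2 * B / R + norm (e N))" .
    then show ?thesis by simp
  qed
  ultimately show thesis using that by blast
qed

lemma sums_0: "(\<lambda>n. h n 0) sums g 0"
proof -
  have "(\<lambda>N. G N 0) \<longlonglongrightarrow> g 0"
  proof (rule LIMSEQ_I)
    fix r :: real assume r: "r > 0"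
    \<comment> \<open>R is fixed first so that 2 B / R < r, and N then makes e N smaller than the
      remaining gap. The summand 1 keeps R positive when B = 0.\<close>
    define R where "R = 4 * B / r + 1"
    have R: "R > 0" using B_nonneg r by (simp add: R_def add_nonneg_pos)
    have "2 * B / R < r"
    proof -
      have "r * R = 4 * B + r" using r by (simp add: R_def distrib_left)
      then have "2 * B < r * R" using B_nonneg r by linarith
      then show ?thesis using R by (simp add: field_simps)
    qed
    obtain e where e: "e \<longlonglongrightarrow> 0" "\<And>N. norm (g 0 - G N 0) \<le> 2 * B / R + norm (e N :: complex)"
      using norm_diff_le[OF R] by blast
    have "r - 2 * B / R > 0" using \<open>2 * B / R < r\<close> by simp
    from LIMSEQ_D[OF e(1) this] obtain N0 where "\<And>N. N \<ge> N0 \<Longrightarrow> norm (e N) < r - 2 * B / R" by auto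
    then have "norm (G N 0 - g 0) < r" if "N \<ge> N0" for N
      using e(2)[of N] that by (fastforce simp: norm_minus_commute)
    then show "\<exists>N0. \<forall>N\<ge>N0. norm (G N 0 - g 0) < r" by blast
  qed
  then show ?thesis by (simp add: sums_def G_def)
qed

end

section \<open>The prime number theorem\<close>

text \<open>The point s = 1 excluded from \<open>block_eq\<close>: here the integral of 1/x is a
  logarithm.\<close>

lemma block_1:
  assumes "n > 0"
  shows "block A n 1 = of_real (A n * (1 / real n - 1 / real (Suc n)) - (ln (real (Suc n)) - ln (real n)))"
proof -
  have "((\<lambda>x. (A n - x) / x\<^sup>2) has_integral
      (- A n / (real n + 1) - ln (real n + 1) - (- A n / real n - ln (real n)))) {real n..real n + 1}"
    using assms
    by (intro fundamental_theorem_of_calculus)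
       (auto intro!: derivative_eq_intros simp: field_simps power2_eq_square simp flip: has_real_derivative_iff_has_vector_derivative)
  also have "- A n / (real n + 1) - ln (real n + 1) - (- A n / real n - ln (real n)) =
      A n * (1 / real n - 1 / real (Suc n)) - (ln (real (Suc n)) - ln (real n))"
    by (simp add: algebra_simps)
  finally have "((\<lambda>x. of_real ((A n - x) / x\<^sup>2) :: complex) has_integral
      of_real (A n * (1 / real n - 1 / real (Suc n)) - (ln (real (Suc n)) - ln (real n)))) {real n..real n + 1}"
    by (rule has_integral_of_real)
  then have "((\<lambda>x. of_real (A n - x) * of_real x powr (- 1 - 1) :: complex) has_integral
      of_real (A n * (1 / real n - 1 / real (Suc n)) - (ln (real (Suc n)) - ln (real n)))) {real n..real n + 1}"
  proof (rule has_integral_eq[rotated])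
    fix x assume "x \<in> {real n..real n + 1}"
    then have "x > 0" using assms by auto
    have "of_real x powr (- 1 - 1) = of_real x powr of_real (- 2 :: real)" by simp
    also have "\<dots> = (of_real (x powr - 2) :: complex)" using \<open>x > 0\<close> by (intro powr_of_real) auto
    also have "x powr - 2 = 1 / x\<^sup>2" using \<open>x > 0\<close> by (simp add: powr_minus powr_numeral divide_inverse)
    finally show "of_real ((A n - x) / x\<^sup>2) = of_real (A n - x) * (of_real x powr (- 1 - 1) :: complex)"
      by simp
  qed
  then show ?thesis
    unfolding block_def by (rule integral_unique)
qed

lemma summable_block_psi_1: "summable (\<lambda>n. Re (block psi (Suc n) 1))"
proof -
  define U where "U = {w. Re w > - 1 \<and> reg_zeta (1 + w) \<noteq> 0}"
  \<comment> \<open>Obtained by solving for the block series F(s) with s = 1 + w: since L = s / (s -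
    1) + s F and L = 1 / (s - 1) - f'/f for f = \<open>reg_zeta\<close>, the poles at s = 1 cancel
    and F = - (1 + f'/f) / s.\<close>
  define g where "g = (\<lambda>w. - (1 + deriv reg_zeta (1 + w) / reg_zeta (1 + w)) / (1 + w))"
  have H: "open {s. Re s > (0 :: real)}" by (rule open_halfspace_Re_gt)
  have shift: "(\<lambda>w. f (1 + w)) holomorphic_on {w. Re w > - 1}" if "f holomorphic_on {s. Re s > 0}" for f
    using holomorphic_on_compose_gen[of "\<lambda>w. 1 + w" "{w. Re w > - 1}" f "{s. Re s > 0}"] that
    by (force simp: o_def intro: holomorphic_intros)
  interpret Newman "\<lambda>n w. block psi (Suc n) (1 + w)" g U 4
  proof
    have "continuous_on {w. Re w > - 1} (\<lambda>w. reg_zeta (1 + w))"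
      by (intro holomorphic_on_imp_continuous_on shift reg_zeta_holomorphic)
    then have "open ({w. Re w > - 1} \<inter> (\<lambda>w. reg_zeta (1 + w)) -` (- {0}))"
      by (rule continuous_open_preimage) (auto simp: open_halfspace_Re_gt)
    also have "{w. Re w > - 1} \<inter> (\<lambda>w. reg_zeta (1 + w)) -` (- {0}) = U"
      by (auto simp: U_def)
    finally show "open U" .
    show "{w. Re w \<ge> 0} \<subseteq> U"
      by (auto simp: U_def intro!: reg_zeta_nonzero)
    have "(\<lambda>w. reg_zeta (1 + w)) holomorphic_on U" "(\<lambda>w. deriv reg_zeta (1 + w)) holomorphic_on U"
      by (rule holomorphic_on_subset[OF shift]; use reg_zeta_holomorphic holomorphic_deriv[OF _ H] in \<open>force simp: U_def\<close>)+
    moreover have "1 + w \<noteq> 0" if "w \<in> U" for w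
      using that by (auto simp: U_def complex_eq_iff)
    ultimately show "g holomorphic_on U"
      unfolding g_def by (intro holomorphic_intros) (auto simp: U_def)
    show "(\<lambda>w. block psi (Suc n) (1 + w)) holomorphic_on UNIV" for n
      using holomorphic_on_compose[of "\<lambda>w. 1 + w" UNIV "block psi (Suc n)"]
      by (simp add: o_def block_holomorphic holomorphic_intros)
    show "norm (block psi (Suc n) (1 + w)) \<le>
        4 * ((real (Suc n) powr - Re w - real (Suc (Suc n)) powr - Re w) / Re w)" if "Re w \<noteq> 0" for n w
      using that by (intro norm_block_le[where b = 1] psi_bound) auto
    fix w assume w: "Re w > 0"
    define s where "s = 1 + w"
    have s: "Re s > 1" "s \<noteq> 0" "s \<noteq> 1" using w by (auto simp: s_def complex_eq_iff)
    have "(\<lambda>n. block psi (Suc n) s) sums (\<Sum>n. block psi (Suc n) s)"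
      by (intro summable_sums summable_block[OF psi_bound] s)
    also have "(\<Sum>n. block psi (Suc n) s) = (mangoldt_series s - s / (s - 1)) / s"
      using mangoldt_series_eq[OF s(1)] s by (simp add: field_simps)
    also have "\<dots> = - (1 + (1 / (s - 1) - mangoldt_series s)) / s"
      using s by (simp add: field_simps)
    also have "\<dots> = g w"
      unfolding g_def s_def[symmetric] reg_zeta_deriv[OF s(1)]
        nonzero_mult_div_cancel_left[OF reg_zeta_nonzero_gt_1[OF s(1)]] ..
    finally show "(\<lambda>n. block psi (Suc n) (1 + w)) sums g w" unfolding s_def .
  qed
  show ?thesis
    using sums_0 by (auto simp: sums_iff intro: summable_Re)
qed

text \<open>For n > 0 this is the real number \<open>block psi n 1\<close>, the integral of (psi(x)
  - x) / x^2 over [n, n + 1].\<close>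

definition chunk :: "nat \<Rightarrow> real" where
  "chunk n = psi n * (1 / real n - 1 / real (Suc n)) - (ln (real (Suc n)) - ln (real n))"

text \<open>For m > 0 both sides are the integral of (c - x) / x^2 over [m, n]. With c = psi m or c
  = psi n, monotonicity compares it with the sum of chunks.\<close>

lemma sum_chunk_eq:
  assumes "m \<le> n"
  shows "c * (1 / real m - 1 / real n) - (ln (real n) - ln (real m)) =
    (\<Sum>k = m..<n. c * (1 / real k - 1 / real (Suc k)) - (ln (real (Suc k)) - ln (real k)))"
  using assms by (induction n rule: dec_induct) (simp_all add: algebra_simps)

lemma psi_mono: "m \<le> n \<Longrightarrow> psi m \<le> psi n"
  by (intro sum_mono2) (auto simp: mangoldt_nonneg)

lemma sum_chunk_ge:
  assumes "0 < m" "m \<le> n"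
  shows "psi m * (1 / real m - 1 / real n) - (ln (real n) - ln (real m)) \<le> (\<Sum>k = m..<n. chunk k)"
  unfolding sum_chunk_eq[OF assms(2)] chunk_def using assms
  by (intro sum_mono diff_right_mono mult_right_mono psi_mono) (auto simp: field_simps)

lemma sum_chunk_le:
  assumes "0 < m" "m \<le> n"
  shows "(\<Sum>k = m..<n. chunk k) \<le> psi n * (1 / real m - 1 / real n) - (ln (real n) - ln (real m))"
  unfolding sum_chunk_eq[OF assms(2)] chunk_def using assms
  by (intro sum_mono diff_right_mono mult_right_mono psi_mono) (auto simp: field_simps)

lemma chunk_Cauchy:
  assumes "e > 0"
  obtains N where "N > 0" "\<And>m n. N \<le> m \<Longrightarrow> \<bar>\<Sum>k = m..<n. chunk k\<bar> < e"
proof -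
  have "summable (\<lambda>n. chunk (Suc n))"
    using summable_block_psi_1 by (simp add: block_1 chunk_def)
  then have "summable chunk" by (simp add: summable_Suc_iff)
  then obtain N where "\<And>m n. N \<le> m \<Longrightarrow> \<bar>\<Sum>k = m..<n. chunk k\<bar> < e"
    using assms unfolding summable_Cauchy by (metis real_norm_def)
  then show thesis by (intro that[of "Suc N"]) auto
qed

lemma psi_over_n_tendsto: "(\<lambda>n. psi n / real n) \<longlonglongrightarrow> 1"
proof (rule order_tendstoI)
  fix a :: real assume "a > 1"
  \<comment> \<open>Half of the contribution of an exact deviation; the other half absorbs the
    rounding of a n to an integer.\<close>
  define c where "c = (a - 1 - ln a) / 2"
  have "ln a < a - 1"
    using \<open>a > 1\<close> ln_le_minus_one[of a] ln_eq_minus_one[of a] by fastforce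
  then have "c > 0" by (simp add: c_def)
  obtain N where N: "N > 0" "\<And>m n. N \<le> m \<Longrightarrow> \<bar>\<Sum>k = m..<n. chunk k\<bar> < c"
    using chunk_Cauchy[OF \<open>c > 0\<close>] by blast
  show "\<forall>\<^sub>F n in sequentially. psi n / real n < a"
  \<comment> \<open>The threshold 1 + 1/c gives c m \<ge> 1. Rounding down makes ln (m / n) \<le> ln
    a for free, so the only loss is a n / m \<le> 1 + c.\<close>
  proof (rule eventually_sequentiallyI[of "max N (nat \<lceil>1 + 1 / c\<rceil>)"], rule ccontr)
    fix n assume n: "max N (nat \<lceil>1 + 1 / c\<rceil>) \<le> n" and "\<not> psi n / real n < a"
    have "n > 0" "N \<le> n" using n N(1) by auto
    have "1 + 1 / c \<le> real n" using n by linarith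
    have psi: "a * real n \<le> psi n"
      using \<open>\<not> _\<close> \<open>n > 0\<close> by (simp add: field_simps)
    define m where "m = nat \<lfloor>a * real n\<rfloor>"
    have "1 * real n \<le> a * real n" using \<open>a > 1\<close> by (intro mult_right_mono) auto
    then have m: "real m \<le> a * real n" "a * real n - 1 < real m" "n \<le> m"
      unfolding m_def by (auto simp: le_nat_floor)
    have "1 / c \<le> real m"
      using \<open>1 + 1 / c \<le> real n\<close> m \<open>1 * real n \<le> _\<close> by linarith
    then have "1 \<le> c * real m" using \<open>c > 0\<close> by (simp add: field_simps)
    then have "a * real n / real m \<le> 1 + c"
      using m \<open>n > 0\<close> by (simp add: field_simps)
    have "ln (real m / real n) \<le> ln a"
      using m \<open>n > 0\<close> \<open>a > 1\<close> by (subst ln_le_cancel_iff) (auto simp: field_simps)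
    then have ln: "ln (real m) - ln (real n) \<le> ln a"
      using m \<open>n > 0\<close> by (simp add: ln_div)
    have "c = a - (1 + c) - ln a" by (simp add: c_def field_simps)
    also have "\<dots> \<le> a - a * real n / real m - (ln (real m) - ln (real n))"
      using ln \<open>a * real n / real m \<le> 1 + c\<close> by linarith
    also have "a - a * real n / real m = a * real n * (1 / real n - 1 / real m)"
      using m \<open>n > 0\<close> by (simp add: field_simps)
    also have "\<dots> \<le> psi n * (1 / real n - 1 / real m)"
      using m \<open>n > 0\<close> by (intro mult_right_mono psi) (auto simp: field_simps)
    also have "\<dots> - (ln (real m) - ln (real n)) \<le> (\<Sum>k = n..<m. chunk k)"
      using m \<open>n > 0\<close> by (intro sum_chunk_ge) auto
    finally show False using N(2)[OF \<open>N \<le> n\<close>, of m] by simp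
  qed
next
  fix b :: real assume "b < 1"
  \<comment> \<open>b may be small or negative; a \<ge> 1/2 makes ln a meaningful and keeps the
    interval from a n to n beyond N.\<close>
  define a where "a = max b (1 / 2)"
  have a: "b \<le> a" "1 / 2 \<le> a" "a < 1" using \<open>b < 1\<close> by (auto simp: a_def)
  define c where "c = (a - 1 - ln a) / 2"
  have "ln a < a - 1"
    using a ln_le_minus_one[of a] ln_eq_minus_one[of a] by fastforce
  then have "c > 0" by (simp add: c_def)
  obtain N where N: "N > 0" "\<And>m n. N \<le> m \<Longrightarrow> \<bar>\<Sum>k = m..<n. chunk k\<bar> < c"
    using chunk_Cauchy[OF \<open>c > 0\<close>] by blast
  show "\<forall>\<^sub>F n in sequentially. b < psi n / real n"
  \<comment> \<open>Since a n \<ge> n / 2, these thresholds give m \<ge> N and 1 / (a n) \<le> c.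
    Rounding up now makes a n / m \<le> 1 for free, and the loss sits in the logarithm.\<close>
  proof (rule eventually_sequentiallyI[of "max (2 * N) (nat \<lceil>2 / c\<rceil>)"], rule ccontr)
    fix n assume n: "max (2 * N) (nat \<lceil>2 / c\<rceil>) \<le> n" and "\<not> b < psi n / real n"
    have "n > 0" "2 * N \<le> n" using n N(1) by auto
    have "2 / c \<le> real n" using n by linarith
    have "psi n / real n \<le> a" using \<open>\<not> _\<close> a by linarith
    then have psi: "psi n \<le> a * real n"
      using \<open>n > 0\<close> by (simp add: field_simps)
    have an: "1 / 2 * real n \<le> a * real n" "a * real n \<le> 1 * real n"
      using a by (intro mult_right_mono; simp)+
    define m where "m = nat \<lceil>a * real n\<rceil>"
    have m: "a * real n \<le> real m" "real m < a * real n + 1"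
      using an by (simp_all add: m_def) linarith+
    have "N \<le> m" "m \<le> n"
      using m an \<open>2 * N \<le> n\<close> by linarith+
    then have "m > 0" using N(1) by simp
    have "a * real n / real m \<le> 1" using m \<open>m > 0\<close> by (simp add: field_simps)
    have "2 \<le> c * real n" using \<open>2 / c \<le> real n\<close> \<open>c > 0\<close> by (simp add: field_simps)
    also have "c * real n \<le> c * (2 * (a * real n))" using an \<open>c > 0\<close> by (intro mult_left_mono) auto
    finally have "1 / (a * real n) \<le> c" using a \<open>n > 0\<close> by (simp add: field_simps)
    have "a * real n * (1 + 1 / (a * real n)) = a * real n + 1"
      using a \<open>n > 0\<close> by (simp add: distrib_left)
    then have "ln (real m) \<le> ln (a * real n * (1 + 1 / (a * real n)))"
      using m \<open>m > 0\<close> by simp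
    also have "\<dots> = ln a + ln (real n) + ln (1 + 1 / (a * real n))"
    proof -
      have "0 < a" using a by linarith
      then have "0 < 1 + 1 / (a * real n)" using \<open>n > 0\<close> by (intro add_pos_pos) auto
      then show ?thesis using \<open>0 < a\<close> \<open>n > 0\<close> by (simp only: ln_mult_pos mult_pos_pos of_nat_0_less_iff)
    qed
    also have "ln (1 + 1 / (a * real n)) \<le> 1 / (a * real n)"
      using a \<open>n > 0\<close> by (intro ln_add_one_self_le_self) auto
    finally have ln: "ln (real m) \<le> ln a + ln (real n) + c"
      using \<open>1 / (a * real n) \<le> c\<close> by linarith
    have "(\<Sum>k = m..<n. chunk k) \<le> psi n * (1 / real m - 1 / real n) - (ln (real n) - ln (real m))"
      using \<open>m > 0\<close> \<open>m \<le> n\<close> by (rule sum_chunk_le)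
    also have "psi n * (1 / real m - 1 / real n) \<le> a * real n * (1 / real m - 1 / real n)"
      using \<open>m > 0\<close> \<open>m \<le> n\<close> by (intro mult_right_mono psi) (auto simp: field_simps)
    also have "\<dots> = a * real n / real m - a"
      using \<open>m > 0\<close> \<open>n > 0\<close> by (simp add: field_simps)
    also have "a * real n / real m - a - (ln (real n) - ln (real m)) \<le> 1 - a + ln a + c"
      using ln \<open>a * real n / real m \<le> 1\<close> by linarith
    also have "\<dots> = - c" by (simp add: c_def field_simps)
    finally show False using N(2)[OF \<open>N \<le> m\<close>, of n] by simp
  qed
qed

theorem theorem2p10:
  shows "chebyshev_psi \<sim>[at_top] (\<lambda>x::real. x)"
proof (rule asymp_equivI')
  have "filterlim (\<lambda>x::real. nat \<lfloor>x\<rfloor>) sequentially at_top"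
    by (intro filterlim_compose[OF filterlim_nat_sequentially] filterlim_floor_sequentially)
  then have "((\<lambda>x::real. psi (nat \<lfloor>x\<rfloor>) / real (nat \<lfloor>x\<rfloor>)) \<longlongrightarrow> 1) at_top"
    by (rule filterlim_compose[OF psi_over_n_tendsto])
  moreover have "((\<lambda>x::real. of_int \<lfloor>x\<rfloor> / x) \<longlongrightarrow> 1) at_top" by real_asymp
  \<comment> \<open>The Chebyshev function is constant between integers, so replacing x by its floor
    costs only the factor floor(x) / x.\<close>
  ultimately have "((\<lambda>x::real. psi (nat \<lfloor>x\<rfloor>) / real (nat \<lfloor>x\<rfloor>) * (of_int \<lfloor>x\<rfloor> / x)) \<longlongrightarrow> 1 * 1) at_top"
    by (rule tendsto_mult)
  moreover have "\<forall>\<^sub>F x::real in at_top. psi (nat \<lfloor>x\<rfloor>) / real (nat \<lfloor>x\<rfloor>) * (of_int \<lfloor>x\<rfloor> / x) = chebyshev_psi x / x"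
    using eventually_ge_at_top[of 1]
  proof eventually_elim
    case (elim x)
    then have "{n. 1 \<le> n \<and> real n \<le> x} = {1..nat \<lfloor>x\<rfloor>}"
      by (auto simp: le_nat_floor) linarith
    moreover have "\<lfloor>x\<rfloor> \<ge> 1" using elim by simp
    ultimately show ?case by (simp add: chebyshev_psi_def)
  qed
  ultimately show "((\<lambda>x. chebyshev_psi x / x) \<longlongrightarrow> 1) at_top"
    by (simp add: tendsto_cong)
qed

end
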